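(* Let $\mathbb{K}$ be an infinite field. If $A$ is a semiprime right Goldie $\mathbb{K}$-algebra, then the polynomial ring $A[x]$ is semiprime right Goldie and $$\mathrm{AD}(A[x])=\mathrm{AD}(A).$$
   Context: Algebras are unital associative $\mathbb{K}$-algebras; $\mathbb{K}^*$ is identified with the nonzero scalar multiples of the identity. For a semiprime right Goldie $\mathbb{K}$-algebra $A$ with classical right quotient ring $\mathrm{Fract}\,A$, the Alev-Dumas invariant is $\mathrm{AD}(A)=\mathrm{GL}_1(\mathrm{Fract}\,A)'\cap\mathbb{K}^*$, the intersection of $\mathbb{K}^*$ with the commutator (derived) subgroup of the group of units of $\mathrm{Fract}\,A$. *)

theory Defs
  imports "HOL-Algebra.UnivPoly" "HOL-Algebra.Generated_Groups" "HOL-Algebra.Ideal_Product" "HOL-Algebra.QuotRing"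
begin

text \<open>Throughout, rings are unital but not necessarily commutative.  The library's
  \<^locale>\<open>algebra\<close> is restricted to commutative algebras, so unital associative algebras
  over a field are introduced here, on the library's \<^locale>\<open>module\<close> records.\<close>

locale assoc_algebra = field K + module K A + A?: ring A
  for K (structure) and A (structure) +
  assumes smult_mult_left:
      "\<lbrakk>k \<in> carrier K; a \<in> carrier A; b \<in> carrier A\<rbrakk> \<Longrightarrow>
        (k \<odot>\<^bsub>A\<^esub> a) \<otimes>\<^bsub>A\<^esub> b = k \<odot>\<^bsub>A\<^esub> (a \<otimes>\<^bsub>A\<^esub> b)"
    and smult_mult_right:
      "\<lbrakk>k \<in> carrier K; a \<in> carrier A; b \<in> carrier A\<rbrakk> \<Longrightarrow>
        a \<otimes>\<^bsub>A\<^esub> (k \<odot>\<^bsub>A\<^esub> b) = k \<odot>\<^bsub>A\<^esub> (a \<otimes>\<^bsub>A\<^esub> b)"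


section \<open>Semiprime right Goldie rings\<close>

locale semiprime_ring = ring R for R (structure) +
  assumes semiprime: "\<lbrakk>ideal I R; I \<cdot> I \<subseteq> {\<zero>}\<rbrakk> \<Longrightarrow> I = {\<zero>}"

definition right_ideal :: "'a set \<Rightarrow> ('a, 'm) ring_scheme \<Rightarrow> bool" where
  "right_ideal I R \<longleftrightarrow> additive_subgroup I R \<and> (\<forall>a\<in>I. \<forall>r\<in>carrier R. a \<otimes>\<^bsub>R\<^esub> r \<in> I)"

definition right_annihilator :: "('a, 'm) ring_scheme \<Rightarrow> 'a set \<Rightarrow> 'a set" where
  "right_annihilator R S = {r \<in> carrier R. \<forall>x\<in>S. x \<otimes>\<^bsub>R\<^esub> r = \<zero>\<^bsub>R\<^esub>}"

text \<open>The sum of the family \<open>I 0, I 1, \<dots>\<close> is direct.\<close>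

definition independent_family :: "('a, 'm) ring_scheme \<Rightarrow> (nat \<Rightarrow> 'a set) \<Rightarrow> bool" where
  "independent_family R I \<longleftrightarrow>
    (\<forall>n x. (\<forall>i<n. x i \<in> I i) \<and> (\<Oplus>\<^bsub>R\<^esub>i\<in>{..<n}. x i) = \<zero>\<^bsub>R\<^esub> \<longrightarrow> (\<forall>i<n. x i = \<zero>\<^bsub>R\<^esub>))"

text \<open>Right Goldie: the ascending chain condition on right annihilators, and no infinite direct
  sum of nonzero right ideals, that is, finite right uniform dimension.\<close>

locale right_goldie_ring = ring R for R (structure) +
  assumes acc_right_annihilators:
      "\<lbrakk>\<And>n. S n \<subseteq> carrier R;
        \<And>n. right_annihilator R (S n) \<subseteq> right_annihilator R (S (Suc n))\<rbrakk> \<Longrightarrow>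
        \<exists>N::nat. \<forall>n\<ge>N. right_annihilator R (S n) = right_annihilator R (S N)"
    and no_infinite_direct_sum:
      "\<lbrakk>\<And>n. right_ideal (I n) R; \<And>n::nat. I n \<noteq> {\<zero>}\<rbrakk> \<Longrightarrow> \<not> independent_family R I"


section \<open>The classical right quotient ring\<close>

definition regular_elems :: "('a, 'm) ring_scheme \<Rightarrow> 'a set" where
  "regular_elems R = {s \<in> carrier R. \<forall>a\<in>carrier R.
     (s \<otimes>\<^bsub>R\<^esub> a = \<zero>\<^bsub>R\<^esub> \<longrightarrow> a = \<zero>\<^bsub>R\<^esub>) \<and> (a \<otimes>\<^bsub>R\<^esub> s = \<zero>\<^bsub>R\<^esub> \<longrightarrow> a = \<zero>\<^bsub>R\<^esub>)}"

text \<open>The pair \<open>(a, s)\<close> stands for the right fraction \<open>a s\<^sup>-\<^sup>1\<close>.  Two fractions are identified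
  when they agree after expansion to a common denominator \<open>s c = t d\<close>.\<close>

definition fract_rel :: "('a, 'm) ring_scheme \<Rightarrow> (('a \<times> 'a) \<times> ('a \<times> 'a)) set" where
  "fract_rel R = {((a, s), (b, t)).
     a \<in> carrier R \<and> b \<in> carrier R \<and> s \<in> regular_elems R \<and> t \<in> regular_elems R \<and>
     (\<exists>c\<in>carrier R. \<exists>d\<in>carrier R. s \<otimes>\<^bsub>R\<^esub> c = t \<otimes>\<^bsub>R\<^esub> d \<and> s \<otimes>\<^bsub>R\<^esub> c \<in> regular_elems R \<and>
        a \<otimes>\<^bsub>R\<^esub> c = b \<otimes>\<^bsub>R\<^esub> d)}"

definition fract_of :: "('a, 'm) ring_scheme \<Rightarrow> 'a \<Rightarrow> ('a \<times> 'a) set" where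
  "fract_of R a = fract_rel R `` {(a, \<one>\<^bsub>R\<^esub>)}"

text \<open>Ore localization at the regular elements:
  \<open>(a s\<^sup>-\<^sup>1) (b t\<^sup>-\<^sup>1) = (a c) (t u)\<^sup>-\<^sup>1\<close> if \<open>b u = s c\<close> with \<open>u\<close> regular, and
  \<open>a s\<^sup>-\<^sup>1 + b t\<^sup>-\<^sup>1 = (a c + b d) (s c)\<^sup>-\<^sup>1\<close> if \<open>s c = t d\<close> is regular.
  This is meaningful when the regular elements satisfy the right Ore condition, as they do in a
  semiprime right Goldie ring by Goldie's theorem; see \<open>Fract_iso\<close> below.\<close>

definition Fract :: "('a, 'm) ring_scheme \<Rightarrow> ('a \<times> 'a) set ring" where
  "Fract R = \<lparr>
     carrier = (carrier R \<times> regular_elems R) // fract_rel R,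
     mult = (\<lambda>p q. fract_rel R `` {(a \<otimes>\<^bsub>R\<^esub> c, t \<otimes>\<^bsub>R\<^esub> u) | a s b t c u.
        (a, s) \<in> p \<and> (b, t) \<in> q \<and> c \<in> carrier R \<and> u \<in> regular_elems R \<and>
        b \<otimes>\<^bsub>R\<^esub> u = s \<otimes>\<^bsub>R\<^esub> c}),
     one = fract_of R \<one>\<^bsub>R\<^esub>,
     zero = fract_of R \<zero>\<^bsub>R\<^esub>,
     add = (\<lambda>p q. fract_rel R `` {(a \<otimes>\<^bsub>R\<^esub> c \<oplus>\<^bsub>R\<^esub> b \<otimes>\<^bsub>R\<^esub> d, s \<otimes>\<^bsub>R\<^esub> c) | a s b t c d.
        (a, s) \<in> p \<and> (b, t) \<in> q \<and> c \<in> carrier R \<and> d \<in> carrier R \<and>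
        s \<otimes>\<^bsub>R\<^esub> c = t \<otimes>\<^bsub>R\<^esub> d \<and> s \<otimes>\<^bsub>R\<^esub> c \<in> regular_elems R})\<rparr>"

locale classical_right_quotient_ring = R?: ring R + Q?: ring Q
  for R (structure) and Q (structure) and \<iota> +
  assumes hom: "\<iota> \<in> ring_hom R Q"
    and inj: "inj_on \<iota> (carrier R)"
    and regular_unit: "s \<in> regular_elems R \<Longrightarrow> \<iota> s \<in> Units Q"
    and fraction: "q \<in> carrier Q \<Longrightarrow>
      \<exists>a\<in>carrier R. \<exists>s\<in>regular_elems R. q = \<iota> a \<otimes>\<^bsub>Q\<^esub> inv\<^bsub>Q\<^esub> (\<iota> s)"


text \<open>Whenever a classical right quotient ring of \<open>R\<close> exists, \<^term>\<open>Fract R\<close> is one,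
  isomorphic to it over \<open>R\<close>.\<close>

lemma (in classical_right_quotient_ring) Fract_iso:
  "\<exists>h\<in>ring_iso (Fract R) Q. \<forall>a\<in>carrier R. h (fract_of R a) = \<iota> a"
proof -
  define v where "v = (\<lambda>(a, s). \<iota> a \<otimes>\<^bsub>Q\<^esub> inv\<^bsub>Q\<^esub> (\<iota> s))"
  define D where "D = carrier R \<times> regular_elems R"
  have reg: "s \<in> carrier R" if "s \<in> regular_elems R" for s
    using that by (simp add: regular_elems_def)
  have regD: "s \<otimes> a = \<zero> \<Longrightarrow> a = \<zero>" "a \<otimes> s = \<zero> \<Longrightarrow> a = \<zero>"
    if "s \<in> regular_elems R" "a \<in> carrier R" for s a
    using that unfolding regular_elems_def by blast+
  have i_closed [simp]: "\<iota> a \<in> carrier Q" if "a \<in> carrier R" for a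
    using hom that by (simp add: ring_hom_closed)
  have i_mult: "\<iota> (a \<otimes> b) = \<iota> a \<otimes>\<^bsub>Q\<^esub> \<iota> b" if "a \<in> carrier R" "b \<in> carrier R" for a b
    using hom that by (simp add: ring_hom_mult)
  have i_add: "\<iota> (a \<oplus> b) = \<iota> a \<oplus>\<^bsub>Q\<^esub> \<iota> b" if "a \<in> carrier R" "b \<in> carrier R" for a b
    using hom that by (simp add: ring_hom_add)
  have i_one: "\<iota> \<one> = \<one>\<^bsub>Q\<^esub>"
    using hom by (simp add: ring_hom_one)
  have one_reg: "\<one> \<in> regular_elems R"
    by (simp add: regular_elems_def)
  have regI: "x \<otimes> y \<in> regular_elems R"
    if xyr: "x \<in> regular_elems R" "y \<in> regular_elems R" for x y
  proof -
    have xy: "x \<in> carrier R" "y \<in> carrier R"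
      using xyr reg by auto
    have "a = \<zero>" if "a \<in> carrier R" "x \<otimes> y \<otimes> a = \<zero>" for a
      using that xy regD[of x "y \<otimes> a"] regD[of y a] xyr by (simp add: R.m_assoc)
    moreover have "a = \<zero>" if "a \<in> carrier R" "a \<otimes> (x \<otimes> y) = \<zero>" for a
      using that xy regD[of y "a \<otimes> x"] regD[of x a] xyr
      by (simp add: R.m_assoc[symmetric])
    ultimately show ?thesis
      using xy unfolding regular_elems_def by blast
  qed
  note ru [simp] = regular_unit
  have ri [simp]: "inv\<^bsub>Q\<^esub> (\<iota> s) \<in> carrier Q" if "s \<in> regular_elems R" for s
    using that by simp
  have linv: "inv\<^bsub>Q\<^esub> (\<iota> s) \<otimes>\<^bsub>Q\<^esub> (\<iota> s \<otimes>\<^bsub>Q\<^esub> x) = x"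
    if "s \<in> regular_elems R" "x \<in> carrier Q" for s x
    using that reg by (simp add: Q.m_assoc[symmetric] Q.Units_l_inv)
  have rinv: "\<iota> s \<otimes>\<^bsub>Q\<^esub> (inv\<^bsub>Q\<^esub> (\<iota> s) \<otimes>\<^bsub>Q\<^esub> x) = x"
    if "s \<in> regular_elems R" "x \<in> carrier Q" for s x
    using that reg by (simp add: Q.m_assoc[symmetric] Q.Units_r_inv)
  have expand: "v (a, s) = v (a \<otimes> c, s \<otimes> c)"
    if "a \<in> carrier R" "s \<in> regular_elems R" "c \<in> carrier R" "s \<otimes> c \<in> regular_elems R" for a s c
  proof -
    have "\<iota> s \<otimes>\<^bsub>Q\<^esub> (\<iota> c \<otimes>\<^bsub>Q\<^esub> inv\<^bsub>Q\<^esub> (\<iota> (s \<otimes> c))) = \<iota> (s \<otimes> c) \<otimes>\<^bsub>Q\<^esub> inv\<^bsub>Q\<^esub> (\<iota> (s \<otimes> c))"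
      using that reg Q.m_assoc[of "\<iota> s" "\<iota> c" "inv\<^bsub>Q\<^esub> (\<iota> (s \<otimes> c))"] i_mult[of s c, symmetric]
      by simp
    also have "\<dots> = \<one>\<^bsub>Q\<^esub>"
      using that by (simp add: Q.Units_r_inv)
    finally have "inv\<^bsub>Q\<^esub> (\<iota> s) = \<iota> c \<otimes>\<^bsub>Q\<^esub> inv\<^bsub>Q\<^esub> (\<iota> (s \<otimes> c))"
      using that reg linv[of s "\<iota> c \<otimes>\<^bsub>Q\<^esub> inv\<^bsub>Q\<^esub> (\<iota> (s \<otimes> c))"] by simp
    then show ?thesis
      using that reg by (simp add: v_def i_mult[of a c] Q.m_assoc)
  qed
  have v_closed: "v x \<in> carrier Q" if "x \<in> D" for x
    using that by (auto simp: v_def D_def)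
  have v_surj: "\<exists>x\<in>D. v x = q" if "q \<in> carrier Q" for q
    using fraction[OF that] unfolding v_def D_def by fastforce
  have solve: "s \<otimes> c = t \<otimes> d" if "s \<in> regular_elems R" "c \<in> carrier R" "t \<in> carrier R"
      "d \<in> regular_elems R" "inv\<^bsub>Q\<^esub> (\<iota> s) \<otimes>\<^bsub>Q\<^esub> \<iota> t = \<iota> c \<otimes>\<^bsub>Q\<^esub> inv\<^bsub>Q\<^esub> (\<iota> d)" for s c t d
  proof -
    have "\<iota> t = \<iota> s \<otimes>\<^bsub>Q\<^esub> (\<iota> c \<otimes>\<^bsub>Q\<^esub> inv\<^bsub>Q\<^esub> (\<iota> d))"
      using that reg rinv[of s "\<iota> t"] by simp
    then have "\<iota> t \<otimes>\<^bsub>Q\<^esub> \<iota> d = \<iota> s \<otimes>\<^bsub>Q\<^esub> \<iota> c"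
      using that reg by (simp add: Q.m_assoc Q.Units_l_inv)
    then have "\<iota> (t \<otimes> d) = \<iota> (s \<otimes> c)"
      using that reg by (simp add: i_mult)
    then show ?thesis
      using inj that reg by (metis R.m_closed inj_onD)
  qed
  have ore: "\<exists>c\<in>carrier R. \<exists>d\<in>regular_elems R. s \<otimes> c = t \<otimes> d \<and>
      inv\<^bsub>Q\<^esub> (\<iota> s) \<otimes>\<^bsub>Q\<^esub> \<iota> t = \<iota> c \<otimes>\<^bsub>Q\<^esub> inv\<^bsub>Q\<^esub> (\<iota> d)"
    if "s \<in> regular_elems R" "t \<in> carrier R" for s t
    using fraction[of "inv\<^bsub>Q\<^esub> (\<iota> s) \<otimes>\<^bsub>Q\<^esub> \<iota> t"] solve that by (metis Q.m_closed i_closed ri)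
  have v_cancel: "a = b"
    if "a \<in> carrier R" "b \<in> carrier R" "s \<in> regular_elems R" "v (a, s) = v (b, s)" for a b s
  proof -
    have "\<iota> x = v (x, s) \<otimes>\<^bsub>Q\<^esub> \<iota> s" if "x \<in> carrier R" for x
      using that \<open>s \<in> regular_elems R\<close> reg by (simp add: v_def Q.m_assoc Q.Units_l_inv)
    then have "\<iota> a = \<iota> b"
      using that by simp
    then show ?thesis
      using inj that by (metis inj_onD)
  qed
  have rel: "((a, s), (b, t)) \<in> fract_rel R \<longleftrightarrow> v (a, s) = v (b, t)"
    if D: "(a, s) \<in> D" "(b, t) \<in> D" for a s b t
  proof
    assume "((a, s), (b, t)) \<in> fract_rel R"
    then obtain c d where "c \<in> carrier R" "d \<in> carrier R" "s \<otimes> c = t \<otimes> d"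
      "s \<otimes> c \<in> regular_elems R" "a \<otimes> c = b \<otimes> d"
      by (auto simp: fract_rel_def)
    then show "v (a, s) = v (b, t)"
      using expand[of a s c] expand[of b t d] D by (simp add: D_def)
  next
    assume eq: "v (a, s) = v (b, t)"
    obtain c d where cd: "c \<in> carrier R" "d \<in> regular_elems R" "s \<otimes> c = t \<otimes> d"
      using ore[of s t] D reg by (auto simp: D_def)
    have r: "s \<otimes> c \<in> regular_elems R"
      using cd D regI by (simp add: D_def)
    have "v (a \<otimes> c, s \<otimes> c) = v (b \<otimes> d, s \<otimes> c)"
      using eq expand[of a s c] expand[of b t d] cd D r reg by (simp add: D_def)
    then have "a \<otimes> c = b \<otimes> d"
      using v_cancel[of "a \<otimes> c" "b \<otimes> d" "s \<otimes> c"] cd D r reg by (simp add: D_def)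
    then show "((a, s), (b, t)) \<in> fract_rel R"
      using cd r D reg[OF cd(2)] unfolding fract_rel_def D_def by blast
  qed
  have rel_D: "fract_rel R \<subseteq> D \<times> D"
    by (auto simp: fract_rel_def D_def)
  define C where "C q = {x \<in> D. v x = q}" for q
  have Image: "fract_rel R `` S = C q" if S: "S \<subseteq> C q" "S \<noteq> {}" for S q
  proof (intro equalityI subsetI)
    fix y assume "y \<in> fract_rel R `` S"
    then obtain x where "x \<in> S" "(x, y) \<in> fract_rel R" by blast
    moreover have "x \<in> C q" "x \<in> D" "y \<in> D"
      using calculation rel_D that by auto
    ultimately show "y \<in> C q"
      using rel[of "fst x" "snd x" "fst y" "snd y"] by (simp add: C_def)
  next
    fix y assume y: "y \<in> C q"
    obtain x where "x \<in> S" "x \<in> C q" using S by blast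
    then show "y \<in> fract_rel R `` S"
      using rel[of "fst x" "snd x" "fst y" "snd y"] y by (auto simp: C_def)
  qed
  have fract_of: "fract_of R a = C (\<iota> a)" if "a \<in> carrier R" for a
    unfolding fract_of_def
  proof (rule Image)
    show "{(a, \<one>)} \<subseteq> C (\<iota> a)"
      using that one_reg by (simp add: C_def D_def v_def i_one)
  qed simp
  have mult: "C p \<otimes>\<^bsub>Fract R\<^esub> C q = C (p \<otimes>\<^bsub>Q\<^esub> q)" if pq: "p \<in> carrier Q" "q \<in> carrier Q" for p q
  proof -
    let ?S = "{(a \<otimes> c, t \<otimes> u) | a s b t c u. (a, s) \<in> C p \<and> (b, t) \<in> C q \<and>
      c \<in> carrier R \<and> u \<in> regular_elems R \<and> b \<otimes> u = s \<otimes> c}"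
    have "?S \<subseteq> C (p \<otimes>\<^bsub>Q\<^esub> q)"
    proof clarify
      fix a s b t c u
      assume *: "(a, s) \<in> C p" "(b, t) \<in> C q" "c \<in> carrier R" "u \<in> regular_elems R"
        "b \<otimes> u = s \<otimes> c"
      then have m: "a \<in> carrier R" "s \<in> regular_elems R" "b \<in> carrier R" "t \<in> regular_elems R"
        and p: "p = \<iota> a \<otimes>\<^bsub>Q\<^esub> inv\<^bsub>Q\<^esub> (\<iota> s)" and q: "q = \<iota> b \<otimes>\<^bsub>Q\<^esub> inv\<^bsub>Q\<^esub> (\<iota> t)"
        by (auto simp: C_def D_def v_def)
      have tu: "t \<otimes> u \<in> regular_elems R"
        using m * regI by simp
      have q': "q = \<iota> (b \<otimes> u) \<otimes>\<^bsub>Q\<^esub> inv\<^bsub>Q\<^esub> (\<iota> (t \<otimes> u))"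
        using expand[of b t u] m * tu reg q by (simp add: v_def)
      have "p \<otimes>\<^bsub>Q\<^esub> q = v (a \<otimes> c, t \<otimes> u)"
        using m * tu reg unfolding p q' *(5)
        by (simp add: v_def i_mult[of s c] i_mult[of a c] Q.m_assoc linv)
      then show "(a \<otimes> c, t \<otimes> u) \<in> C (p \<otimes>\<^bsub>Q\<^esub> q)"
        using m * tu by (simp add: C_def D_def)
    qed
    moreover have "?S \<noteq> {}"
    proof -
      obtain a s where as: "(a, s) \<in> C p" using v_surj[OF pq(1)] by (auto simp: C_def)
      obtain b t where bt: "(b, t) \<in> C q" using v_surj[OF pq(2)] by (auto simp: C_def)
      have "s \<in> regular_elems R" "b \<in> carrier R"
        using as bt by (auto simp: C_def D_def)
      then have "\<exists>c\<in>carrier R. \<exists>u\<in>regular_elems R. b \<otimes> u = s \<otimes> c"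
        using ore[of s b] by metis
      then show ?thesis using as bt by blast
    qed
    ultimately show ?thesis
      unfolding Fract_def by (simp add: Image)
  qed
  have add: "C p \<oplus>\<^bsub>Fract R\<^esub> C q = C (p \<oplus>\<^bsub>Q\<^esub> q)" if pq: "p \<in> carrier Q" "q \<in> carrier Q" for p q
  proof -
    let ?S = "{(a \<otimes> c \<oplus> b \<otimes> d, s \<otimes> c) | a s b t c d. (a, s) \<in> C p \<and> (b, t) \<in> C q \<and>
      c \<in> carrier R \<and> d \<in> carrier R \<and> s \<otimes> c = t \<otimes> d \<and> s \<otimes> c \<in> regular_elems R}"
    have "?S \<subseteq> C (p \<oplus>\<^bsub>Q\<^esub> q)"
    proof clarify
      fix a s b t c d
      assume *: "(a, s) \<in> C p" "(b, t) \<in> C q" "c \<in> carrier R" "d \<in> carrier R"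
        "s \<otimes> c = t \<otimes> d" "s \<otimes> c \<in> regular_elems R"
      then have m: "a \<in> carrier R" "s \<in> regular_elems R" "b \<in> carrier R" "t \<in> regular_elems R"
        and p: "p = v (a, s)" and q: "q = v (b, t)"
        by (auto simp: C_def D_def)
      have "p = v (a \<otimes> c, s \<otimes> c)" "q = v (b \<otimes> d, s \<otimes> c)"
        using expand[of a s c] expand[of b t d] m * p q by simp_all
      then have "p \<oplus>\<^bsub>Q\<^esub> q = v (a \<otimes> c \<oplus> b \<otimes> d, s \<otimes> c)"
        using m * by (simp add: v_def i_add Q.l_distr)
      then show "(a \<otimes> c \<oplus> b \<otimes> d, s \<otimes> c) \<in> C (p \<oplus>\<^bsub>Q\<^esub> q)"
        using m * by (simp add: C_def D_def)
    qed
    moreover have "?S \<noteq> {}"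
    proof -
      obtain a s where as: "(a, s) \<in> C p" using v_surj[OF pq(1)] by (auto simp: C_def)
      obtain b t where bt: "(b, t) \<in> C q" using v_surj[OF pq(2)] by (auto simp: C_def)
      have "s \<in> regular_elems R" "t \<in> regular_elems R"
        using as bt by (auto simp: C_def D_def)
      then have "\<exists>c\<in>carrier R. \<exists>d\<in>carrier R. s \<otimes> c = t \<otimes> d \<and> s \<otimes> c \<in> regular_elems R"
        using ore[of s t] reg regI by metis
      then show ?thesis using as bt by blast
    qed
    ultimately show ?thesis
      unfolding Fract_def by (simp add: Image)
  qed
  have carrier: "carrier (Fract R) = C ` carrier Q"
  proof -
    have "fract_rel R `` {x} = C (v x)" if "x \<in> D" for x
      using that by (intro Image) (auto simp: C_def)
    then have "carrier (Fract R) = C ` v ` D"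
      by (auto simp: Fract_def quotient_def D_def[symmetric])
    moreover have "v ` D = carrier Q"
      using v_closed v_surj by blast
    ultimately show ?thesis by simp
  qed
  define h where "h P = the_elem (v ` P)" for P
  have hC: "h (C q) = q" if "q \<in> carrier Q" for q
  proof -
    have "v ` C q = {q}"
      using v_surj[OF that] by (auto simp: C_def)
    then show ?thesis by (simp add: h_def)
  qed
  have "h \<in> ring_iso (Fract R) Q"
    unfolding ring_iso_def
  proof (intro CollectI conjI ring_hom_memI)
    show "h \<one>\<^bsub>Fract R\<^esub> = \<one>\<^bsub>Q\<^esub>"
      by (simp add: Fract_def fract_of i_one hC)
    show "bij_betw h (carrier (Fract R)) (carrier Q)"
      unfolding carrier by (auto simp: bij_betw_def inj_on_def hC image_image)
  qed (auto simp: carrier mult add hC)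
  moreover have "\<forall>a\<in>carrier R. h (fract_of R a) = \<iota> a"
    by (simp add: fract_of hC)
  ultimately show ?thesis by blast
qed


section \<open>The Alev-Dumas invariant\<close>

text \<open>A nonzero scalar \<open>k\<close> is identified with \<open>k\<cdot>1\<close>; the invariant is formed as a subset of
  \<open>K\<^sup>*\<close> itself, so that its values for different algebras can be compared.\<close>

definition AD :: "('k, 'n) ring_scheme \<Rightarrow> ('k, 'a, 'm) module_scheme \<Rightarrow> 'k set" where
  "AD K A = {k \<in> carrier K - {\<zero>\<^bsub>K\<^esub>}.
     fract_of A (k \<odot>\<^bsub>A\<^esub> \<one>\<^bsub>A\<^esub>) \<in> derived (units_of (Fract A)) (Units (Fract A))}"


section \<open>Polynomial rings\<close>

text \<open>The library's \<^term>\<open>UP A\<close> carries scalars from \<open>A\<close>; here they are restricted to the base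
  field of \<open>A\<close>.\<close>

definition poly_algebra :: "('k, 'a, 'm) module_scheme \<Rightarrow> ('k, nat \<Rightarrow> 'a) module" where
  "poly_algebra A = \<lparr>
     carrier = carrier (UP A), mult = mult (UP A), one = one (UP A),
     zero = zero (UP A), add = add (UP A),
     smult = (\<lambda>k p n. k \<odot>\<^bsub>A\<^esub> p n)\<rparr>"

lemma poly_algebra_assoc_algebra:
  assumes "assoc_algebra K A"
  shows "assoc_algebra K (poly_algebra A)"
proof -
  interpret assoc_algebra K A by fact
  interpret U: UP_ring A "UP A" by unfold_locales
  have P: "carrier (poly_algebra A) = up A" "mult (poly_algebra A) = mult (UP A)"
    "one (poly_algebra A) = one (UP A)" "zero (poly_algebra A) = zero (UP A)"
    "add (poly_algebra A) = add (UP A)" "smult (poly_algebra A) = (\<lambda>k p n. k \<odot>\<^bsub>A\<^esub> p n)"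
    by (simp_all add: poly_algebra_def UP_def)
  have C: "carrier (UP A) = up A"
    by (simp add: UP_def)
  have "abelian_group (poly_algebra A)"
  proof (rule abelian_groupI)
    fix x assume "x \<in> carrier (poly_algebra A)"
    then show "\<exists>y\<in>carrier (poly_algebra A). y \<oplus>\<^bsub>poly_algebra A\<^esub> x = \<zero>\<^bsub>poly_algebra A\<^esub>"
      by (metis C P(1,4,5) U.P.l_neg U.P.a_inv_closed)
  qed (simp_all add: P C[symmetric] U.P.a_ac)
  moreover have "monoid (poly_algebra A)"
    by (rule monoidI) (simp_all add: P C[symmetric] U.P.m_assoc)
  ultimately have ring: "ring (poly_algebra A)"
    by (rule ringI) (simp_all add: P C[symmetric] U.P.l_distr U.P.r_distr)
  have smult_zero: "k \<odot>\<^bsub>A\<^esub> \<zero>\<^bsub>A\<^esub> = \<zero>\<^bsub>A\<^esub>" if "k \<in> carrier K" for k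
    using that by (rule smult_r_null)
  have closed: "(\<lambda>n. k \<odot>\<^bsub>A\<^esub> p n) \<in> up A" if "k \<in> carrier K" "p \<in> up A" for k p
    using that smult_zero unfolding up_def bound_def by fastforce
  have add: "p \<oplus>\<^bsub>UP A\<^esub> q = (\<lambda>n. p n \<oplus>\<^bsub>A\<^esub> q n)" if "p \<in> up A" "q \<in> up A" for p q
    using that by (simp add: UP_def)
  have mult: "p \<otimes>\<^bsub>UP A\<^esub> q = (\<lambda>n. \<Oplus>\<^bsub>A\<^esub>i\<in>{..n}. p i \<otimes>\<^bsub>A\<^esub> q (n - i))"
    if "p \<in> up A" "q \<in> up A" for p q
    using that by (simp add: UP_def)
  have coeff [simp]: "p n \<in> carrier A" if "p \<in> up A" for p n
    using that by (rule mem_upD)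
  have "module K (poly_algebra A)"
    by (rule moduleI)
      (use ring in \<open>auto simp: ring_def P closed add up_add_closed smult_l_distr smult_r_distr
        smult_assoc1 intro: is_cring\<close>)
  then show ?thesis
    using ring field_axioms
    by (intro assoc_algebra.intro assoc_algebra_axioms.intro)
      (auto simp: P closed mult finsum_smult_ldistr smult_mult_left smult_mult_right
        intro!: ext M.finsum_cong')
qed

end

(* Saturated right ideals of A (a s in I with s regular implies a in I) are the contractions of the
   right ideals of the semisimple ring Fract A.  By Goldie's theorem they satisfy the ascending chain
   condition, and the Hilbert basis argument carries this over to the right ideals of A[x] saturated
   with respect to the regular constants.  Right annihilators are saturated, and an infinite direct
   sum would give a strictly increasing chain of saturations, so A[x] is right Goldie.

   For AD, the constants embed Fract A into Fract A[x].  Conversely, let f be regular in A[x] and let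
   b annihilate f(k) from the right, so that f b = (x - k) g; if b is nonzero, g is an eigenvector of
   multiplication by x on A[x] modulo the saturation of f A[x], with eigenvalue k.  Eigenspaces for
   distinct k are independent, so f(k) is regular for all but finitely many k in K.  Hence evaluation
   at almost every k maps an expression of a scalar as a product of commutators in Fract A[x] to such
   an expression in Fract A. *)

theory Submission
  imports Defs
begin

section \<open>Right ideals and independent sums\<close>

text \<open>Evaluation at k does not extend to all of \<open>Fract A[x]\<close>: a regular
  polynomial may turn into a zero divisor at k, and over a noncommutative ring no determinant bounds
  the number of such k. The eigenspace argument replaces the determinant, and it consumes the same
  chain condition that makes \<open>A[x]\<close> Goldie. That condition cannot be asked of all right
  ideals of \<open>A[x]\<close>, since A need not be Noetherian. The right ideals saturated at the
  regular constants are the ones that come from \<open>(Fract A)[x]\<close>, which is right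
  Noetherian. Scalars enter through two properties: they are central, which makes evaluation
  multiplicative, and distinct ones differ by a unit, which separates eigenvalues. Membership in a
  derived subgroup involves finitely many fractions, each of which excludes finitely many k; an
  infinite field leaves one k over.\<close>

lemma chain_stabilizes:
  fixes I :: "nat \<Rightarrow> 's set"
  assumes step: "\<And>g::nat \<Rightarrow> nat. strict_mono g \<Longrightarrow> \<exists>n. I (g (Suc n)) = I (g n)"
  shows "\<exists>N. \<forall>n\<ge>N. I n = I N"
proof (rule ccontr)
  assume "\<not> ?thesis"
  then have "\<exists>m>n. I m \<noteq> I n" for n
    by (metis order_le_less)
  then obtain f where f: "f n > n" "I (f n) \<noteq> I n" for n
    by metis
  define g where "g n = (f ^^ n) 0" for n
  have "strict_mono g"
    by (simp add: strict_mono_Suc_iff g_def f)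
  then show False
    using step[of g] f by (auto simp: g_def)
qed

context ring
begin

lemma minus_eq_zero_iff: "\<lbrakk>a \<in> carrier R; b \<in> carrier R\<rbrakk> \<Longrightarrow> a \<ominus> b = \<zero> \<longleftrightarrow> a = b"
  by (metis a_minus_def add.inv_closed minus_equality r_neg)

text \<open>Closure under negation is automatic in a unital ring, because
  \<open>\<ominus> a = a \<otimes> (\<ominus> \<one>)\<close>.\<close>

lemma right_idealI:
  assumes "I \<subseteq> carrier R" "\<zero> \<in> I" "\<And>a b. \<lbrakk>a \<in> I; b \<in> I\<rbrakk> \<Longrightarrow> a \<oplus> b \<in> I"
    "\<And>a r. \<lbrakk>a \<in> I; r \<in> carrier R\<rbrakk> \<Longrightarrow> a \<otimes> r \<in> I"
  shows "right_ideal I R"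
proof -
  have "\<ominus> a \<in> I" if "a \<in> I" for a
  proof -
    have "a \<otimes> (\<ominus> \<one>) = \<ominus> a"
      using assms(1) that by (simp add: r_minus subset_iff)
    then show ?thesis
      using assms(4)[OF that, of "\<ominus> \<one>"] by simp
  qed
  then show ?thesis
    unfolding right_ideal_def additive_subgroup_def subgroup_def
    using assms by (auto simp flip: a_inv_def)
qed

lemma right_idealD:
  assumes "right_ideal I R"
  shows "I \<subseteq> carrier R" "\<zero> \<in> I" "\<lbrakk>a \<in> I; b \<in> I\<rbrakk> \<Longrightarrow> a \<oplus> b \<in> I"
    "\<lbrakk>a \<in> I; r \<in> carrier R\<rbrakk> \<Longrightarrow> a \<otimes> r \<in> I" "a \<in> I \<Longrightarrow> \<ominus> a \<in> I"
    "\<lbrakk>a \<in> I; b \<in> I\<rbrakk> \<Longrightarrow> a \<ominus> b \<in> I"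
proof -
  interpret additive_subgroup I R
    using assms by (simp add: right_ideal_def)
  show *: "I \<subseteq> carrier R" "\<zero> \<in> I" "\<lbrakk>a \<in> I; b \<in> I\<rbrakk> \<Longrightarrow> a \<oplus> b \<in> I"
    for a b using a_subset by auto
  show m: "\<lbrakk>a \<in> I; r \<in> carrier R\<rbrakk> \<Longrightarrow> a \<otimes> r \<in> I" for a r
    using assms by (simp add: right_ideal_def)
  show n: "a \<in> I \<Longrightarrow> \<ominus> a \<in> I" for a
    using m[of a "\<ominus> \<one>"] *(1) by (auto simp: r_minus)
  show "\<lbrakk>a \<in> I; b \<in> I\<rbrakk> \<Longrightarrow> a \<ominus> b \<in> I"
    using * n by (simp add: a_minus_def)
qed

lemma right_ideal_finsum:
  assumes "right_ideal I R" "finite F" "\<And>i. i \<in> F \<Longrightarrow> x i \<in> I"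
  shows "(\<Oplus>i\<in>F. x i) \<in> I"
  using assms(2,3)
proof (induction F rule: finite_induct)
  case (insert j F)
  then have "x \<in> F \<rightarrow> carrier R" "x j \<in> carrier R"
    using right_idealD(1)[OF assms(1)] by auto
  then show ?case
    using insert right_idealD(3)[OF assms(1)] by simp
qed (simp add: right_idealD(2)[OF assms(1)])

lemma right_ideal_left_mult_image:
  assumes "right_ideal I R" "a \<in> carrier R"
  shows "right_ideal ((\<otimes>) a ` I) R"
proof (rule right_idealI)
  note I = right_idealD[OF assms(1)]
  show "(\<otimes>) a ` I \<subseteq> carrier R" "\<zero> \<in> (\<otimes>) a ` I"
    using I(1,2) assms(2) by (auto intro: rev_image_eqI)
  show "u \<oplus> v \<in> (\<otimes>) a ` I" if uv: "u \<in> (\<otimes>) a ` I" "v \<in> (\<otimes>) a ` I" for u v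
  proof -
    obtain x y where "x \<in> I" "u = a \<otimes> x" "y \<in> I" "v = a \<otimes> y" using uv by blast
    then have "u \<oplus> v = a \<otimes> (x \<oplus> y)" "x \<oplus> y \<in> I"
      using I(1,3) assms(2) by (auto simp: r_distr subset_iff)
    then show ?thesis by blast
  qed
  show "u \<otimes> v \<in> (\<otimes>) a ` I" if uv: "u \<in> (\<otimes>) a ` I" "v \<in> carrier R" for u v
  proof -
    obtain x where "x \<in> I" "u = a \<otimes> x" using uv by blast
    then have "u \<otimes> v = a \<otimes> (x \<otimes> v)" "x \<otimes> v \<in> I"
      using I(1,4) assms(2) uv by (auto simp: m_assoc subset_iff)
    then show ?thesis by blast
  qed
qed

lemma right_ideal_carrier: "right_ideal (carrier R) R"
  by (rule right_idealI) auto

lemma right_ideal_left_mult_vimage: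
  assumes "right_ideal I R" "a \<in> carrier R"
  shows "right_ideal {r \<in> carrier R. a \<otimes> r \<in> I} R"
proof (rule right_idealI)
  note I = right_idealD[OF assms(1)]
  show "\<zero> \<in> {r \<in> carrier R. a \<otimes> r \<in> I}"
    using I(2) assms(2) by simp
  show "u \<oplus> v \<in> {r \<in> carrier R. a \<otimes> r \<in> I}"
    if "u \<in> {r \<in> carrier R. a \<otimes> r \<in> I}" "v \<in> {r \<in> carrier R. a \<otimes> r \<in> I}" for u v
    using that I(3) assms(2) by (simp add: r_distr)
  show "u \<otimes> v \<in> {r \<in> carrier R. a \<otimes> r \<in> I}"
    if "u \<in> {r \<in> carrier R. a \<otimes> r \<in> I}" "v \<in> carrier R" for u v
    using that I(4)[of "a \<otimes> u" v] assms(2) by (simp add: m_assoc)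
qed auto

lemma right_ideal_Int:
  assumes "right_ideal I R" "right_ideal J R"
  shows "right_ideal (I \<inter> J) R"
  using right_idealD[OF assms(1)] right_idealD[OF assms(2)] by (intro right_idealI) auto

lemma right_ideal_annihilator:
  assumes "S \<subseteq> carrier R"
  shows "right_ideal (right_annihilator R S) R"
  unfolding right_annihilator_def
proof (rule right_idealI, goal_cases)
  case (4 a r)
  then show ?case using assms by (auto simp: m_assoc[symmetric] subset_iff)
qed (use assms in \<open>auto simp: r_distr subset_iff\<close>)

text \<open>Along a descending filtration the terms vanish from the lowest index on: once
  \<open>x j\<close> is zero for j < i, the relation makes \<open>x i\<close> the negative of a sum
  of later terms, which lies in \<open>B (Suc i)\<close>, and assumption \<open>J\<close>
  applies.\<close>

lemma independent_descending:
  fixes n :: nat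
  assumes B: "\<And>i. right_ideal (B i) R" "\<And>i. B (Suc i) \<subseteq> B i"
    and x: "\<And>i. i < n \<Longrightarrow> x i \<in> B i"
    and J: "\<And>i. \<lbrakk>i < n; x i \<in> B (Suc i)\<rbrakk> \<Longrightarrow> x i = \<zero>"
    and sum: "(\<Oplus>i\<in>{..<n}. x i) = \<zero>"
    and i: "i < n"
  shows "x i = \<zero>"
  using i
proof (induction i rule: less_induct)
  case (less i)
  have c: "x j \<in> carrier R" if "j < n" for j
    using x[OF that] right_idealD(1)[OF B(1)] by auto
  have dec: "B j \<subseteq> B k" if "k \<le> j" for j k
    using lift_Suc_antimono_le[of B, OF B(2) that] .
  have split: "{..<n} = {..<i} \<union> insert i {Suc i..<n}"
    using less.prems by auto
  have tail: "(\<Oplus>j\<in>{Suc i..<n}. x j) \<in> B (Suc i)"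
  proof (rule right_ideal_finsum[OF B(1)])
    fix j assume "j \<in> {Suc i..<n}"
    then show "x j \<in> B (Suc i)"
      using x[of j] dec[of "Suc i" j] by auto
  qed simp
  have "(\<Oplus>j\<in>{..<i}. x j) = (\<Oplus>j\<in>{..<i}. \<zero>)"
    using less by (intro finsum_cong') auto
  then have "x i \<oplus> (\<Oplus>j\<in>{Suc i..<n}. x j) = \<zero>"
    using sum unfolding split
    by (subst (asm) finsum_Un_disjoint) (use c less.prems in \<open>auto simp: Pi_def\<close>)
  then have "x i = \<ominus> (\<Oplus>j\<in>{Suc i..<n}. x j)"
    using c less.prems tail right_idealD(1)[OF B(1)[of "Suc i"]]
    by (intro minus_equality[symmetric]) auto
  then show ?case
    using J[OF less.prems] right_idealD(5)[OF B(1) tail] by simp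
qed

text \<open>Along an ascending filtration the last term goes first: \<open>x n\<close> is the
  negative of the sum of the earlier terms, which lies in \<open>B n\<close>. Hence the induction on
  the number of terms.\<close>

lemma independent_ascending:
  fixes n :: nat
  assumes B: "\<And>i. right_ideal (B i) R" "\<And>i. B i \<subseteq> B (Suc i)"
    and x: "\<And>i. i < n \<Longrightarrow> x i \<in> B (Suc i)"
    and J: "\<And>i. \<lbrakk>i < n; x i \<in> B i\<rbrakk> \<Longrightarrow> x i = \<zero>"
    and sum: "(\<Oplus>i\<in>{..<n}. x i) = \<zero>"
    and i: "i < n"
  shows "x i = \<zero>"
  using x J sum i
proof (induction n arbitrary: i)
  case (Suc n)
  have asc: "B j \<subseteq> B k" if "j \<le> k" for j k
    using lift_Suc_mono_le[of B, OF B(2) that] .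
  have c: "x j \<in> carrier R" if "j < Suc n" for j
    using Suc.prems(1)[OF that] right_idealD(1)[OF B(1)] by auto
  have head: "(\<Oplus>j\<in>{..<n}. x j) \<in> B n"
  proof (rule right_ideal_finsum[OF B(1)])
    fix j assume "j \<in> {..<n}"
    then show "x j \<in> B n"
      using Suc.prems(1)[of j] asc[of "Suc j" n] by auto
  qed simp
  have s: "x n \<oplus> (\<Oplus>j\<in>{..<n}. x j) = \<zero>"
    using Suc.prems(3) c by (subst (asm) lessThan_Suc, subst (asm) finsum_insert) (auto simp: Pi_def)
  then have "x n = \<ominus> (\<Oplus>j\<in>{..<n}. x j)"
    using c head right_idealD(1)[OF B(1)[of n]]
    by (intro minus_equality[symmetric]) auto
  then have 0: "x n = \<zero>"
    using Suc.prems(2)[of n] right_idealD(5)[OF B(1) head] by simp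
  then have sum: "(\<Oplus>j\<in>{..<n}. x j) = \<zero>"
    using s head right_idealD(1)[OF B(1)[of n]] by auto
  show ?case
  proof (cases "i = n")
    case False
    show ?thesis
      by (rule Suc.IH) (use Suc.prems(1,2,4) sum False in auto)
  qed (simp add: 0)
qed simp

end

context right_goldie_ring
begin

text \<open>This is how finite uniform dimension is used on descending chains: only consecutive
  stages have to be compared, never a whole sum.\<close>

lemma no_descending_sum:
  assumes "\<And>i::nat. right_ideal (B i) R" "\<And>i. B (Suc i) \<subseteq> B i"
    and J: "\<And>i. right_ideal (J i) R" "\<And>i. J i \<noteq> {\<zero>}" "\<And>i. J i \<subseteq> B i"
      "\<And>i. J i \<inter> B (Suc i) \<subseteq> {\<zero>}"
  shows False
proof -
  have "independent_family R J"
    unfolding independent_family_def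
  proof (intro allI impI, elim conjE)
    fix n x and i :: nat
    assume *: "\<forall>i<n. x i \<in> J i" "(\<Oplus>i\<in>{..<n}. x i) = \<zero>" "i < n"
    show "x i = \<zero>"
      by (rule independent_descending[where B = B and n = n, OF assms(1,2)]) (use * J(3,4) in blast)+
  qed
  then show False
    using no_infinite_direct_sum[of J] J by blast
qed

lemma no_ascending_sum:
  assumes "\<And>i::nat. right_ideal (B i) R" "\<And>i. B i \<subseteq> B (Suc i)"
    and J: "\<And>i. right_ideal (J i) R" "\<And>i. J i \<noteq> {\<zero>}" "\<And>i. J i \<subseteq> B (Suc i)"
      "\<And>i. J i \<inter> B i \<subseteq> {\<zero>}"
  shows False
proof -
  have "independent_family R J"
    unfolding independent_family_def
  proof (intro allI impI, elim conjE)
    fix n x and i :: nat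
    assume *: "\<forall>i<n. x i \<in> J i" "(\<Oplus>i\<in>{..<n}. x i) = \<zero>" "i < n"
    show "x i = \<zero>"
      by (rule independent_ascending[where B = B and n = n, OF assms(1,2)]) (use * J(3,4) in blast)+
  qed
  then show False
    using no_infinite_direct_sum[of J] J by blast
qed

end

section \<open>Goldie's theorem\<close>

lemma right_annihilator_singleton [simp]:
  "y \<in> right_annihilator R {x} \<longleftrightarrow> y \<in> carrier R \<and> x \<otimes>\<^bsub>R\<^esub> y = \<zero>\<^bsub>R\<^esub>"
  by (auto simp: right_annihilator_def)

section \<open>Essential right ideals and regular elements\<close>

context ring
begin

text \<open>Only the principal right ideals a R are tested. This is the usual condition, since every
  nonzero right ideal contains a nonzero principal one.\<close>

definition essential :: "'a set \<Rightarrow> bool" where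
  "essential E \<longleftrightarrow> right_ideal E R \<and>
    (\<forall>a\<in>carrier R - {\<zero>}. \<exists>r\<in>carrier R. a \<otimes> r \<in> E \<and> a \<otimes> r \<noteq> \<zero>)"

lemma essential_mono:
  assumes "essential E" "right_ideal I R" "E \<subseteq> I"
  shows "essential I"
  using assms unfolding essential_def by blast

text \<open>If a b is zero, b itself lies in the preimage; otherwise a nonzero multiple of a b in E
  is pulled back. Applied to E = s R, this is the source of the Ore condition.\<close>

lemma essential_vimage:
  assumes "essential E" "a \<in> carrier R"
  shows "essential {r \<in> carrier R. a \<otimes> r \<in> E}"
proof -
  have E: "right_ideal E R" and ess: "\<And>b. \<lbrakk>b \<in> carrier R; b \<noteq> \<zero>\<rbrakk> \<Longrightarrow>
      \<exists>r\<in>carrier R. b \<otimes> r \<in> E \<and> b \<otimes> r \<noteq> \<zero>"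
    using assms(1) by (auto simp: essential_def)
  have "\<exists>r\<in>carrier R. b \<otimes> r \<in> {r \<in> carrier R. a \<otimes> r \<in> E} \<and> b \<otimes> r \<noteq> \<zero>"
    if b: "b \<in> carrier R" "b \<noteq> \<zero>" for b
  proof (cases "a \<otimes> b = \<zero>")
    case True
    then show ?thesis
      using b right_idealD(2)[OF E] by (intro bexI[of _ \<one>]) auto
  next
    case False
    then obtain r where r: "r \<in> carrier R" "a \<otimes> b \<otimes> r \<in> E" "a \<otimes> b \<otimes> r \<noteq> \<zero>"
      using ess[of "a \<otimes> b"] b assms(2) by auto
    then have "a \<otimes> (b \<otimes> r) \<in> E" "b \<otimes> r \<noteq> \<zero>"
      using b assms(2) by (auto simp: m_assoc)
    then show ?thesis
      using b r(1) by (intro bexI[of _ r]) auto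
  qed
  then show ?thesis
    unfolding essential_def using right_ideal_left_mult_vimage[OF E assms(2)] by auto
qed

lemma regular_elemsD:
  assumes "s \<in> regular_elems R"
  shows "s \<in> carrier R" "\<lbrakk>a \<in> carrier R; s \<otimes> a = \<zero>\<rbrakk> \<Longrightarrow> a = \<zero>"
    "\<lbrakk>a \<in> carrier R; a \<otimes> s = \<zero>\<rbrakk> \<Longrightarrow> a = \<zero>"
  using assms unfolding regular_elems_def by blast+

lemma one_regular: "\<one> \<in> regular_elems R"
  by (simp add: regular_elems_def)

lemma regular_mult:
  assumes "s \<in> regular_elems R" "t \<in> regular_elems R"
  shows "s \<otimes> t \<in> regular_elems R"
proof -
  note s = regular_elemsD[OF assms(1)] and t = regular_elemsD[OF assms(2)]
  have "a = \<zero>" if "a \<in> carrier R" "s \<otimes> t \<otimes> a = \<zero>" for a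
    using that s(1) s(2)[of "t \<otimes> a"] t(1) t(2)[of a] by (simp add: m_assoc)
  moreover have "a = \<zero>" if "a \<in> carrier R" "a \<otimes> (s \<otimes> t) = \<zero>" for a
    using that s(1) t(3)[of "a \<otimes> s"] t(1) s(3)[of a] by (simp add: m_assoc[symmetric])
  ultimately show ?thesis
    using s(1) t(1) unfolding regular_elems_def by blast
qed

end

lemma (in semiprime_ring) semiprime_element:
  assumes a: "a \<in> carrier R" and "\<And>x. x \<in> carrier R \<Longrightarrow> a \<otimes> x \<otimes> a = \<zero>"
  shows "a = \<zero>"
proof -
  \<comment> \<open>The right annihilator \<open>L\<close> of \<open>a R\<close> contains \<open>a\<close>; the elements of \<open>L\<close> annihilating \<open>L\<close> form an
    ideal of square zero, which still contains \<open>a\<close>.\<close>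
  define L where "L = {y \<in> carrier R. \<forall>x\<in>carrier R. a \<otimes> x \<otimes> y = \<zero>}"
  define M where "M = {z \<in> L. \<forall>y\<in>L. z \<otimes> y = \<zero>}"
  have L: "x \<otimes> y \<in> L" "y \<otimes> x \<in> L" if x: "x \<in> carrier R" and y: "y \<in> L" for x y
  proof -
    have y: "y \<in> carrier R" "\<And>x. x \<in> carrier R \<Longrightarrow> a \<otimes> x \<otimes> y = \<zero>"
      using y by (auto simp: L_def)
    have "a \<otimes> z \<otimes> (x \<otimes> y) = \<zero>" "a \<otimes> z \<otimes> (y \<otimes> x) = \<zero>" if z: "z \<in> carrier R" for z
    proof -
      have "a \<otimes> z \<otimes> (x \<otimes> y) = a \<otimes> (z \<otimes> x) \<otimes> y" "a \<otimes> z \<otimes> (y \<otimes> x) = a \<otimes> z \<otimes> y \<otimes> x"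
        using x y(1) a z by (simp_all add: m_assoc)
      then show "a \<otimes> z \<otimes> (x \<otimes> y) = \<zero>" "a \<otimes> z \<otimes> (y \<otimes> x) = \<zero>"
        using x y(2) z by simp_all
    qed
    then show "x \<otimes> y \<in> L" "y \<otimes> x \<in> L"
      using x y by (auto simp: L_def)
  qed
  have Lc: "y \<in> carrier R" if "y \<in> L" for y
    using that by (simp add: L_def)
  have Ladd: "x \<oplus> y \<in> L" if "x \<in> L" "y \<in> L" for x y
    using that a by (simp add: L_def r_distr)
  have L0: "\<zero> \<in> L"
    using a by (simp add: L_def)
  have M: "right_ideal M R"
  proof (rule right_idealI)
    show "M \<subseteq> carrier R" "\<zero> \<in> M"
      using Lc L0 by (auto simp: M_def)
    show "x \<oplus> y \<in> M" if "x \<in> M" "y \<in> M" for x y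
      using that Lc Ladd by (simp add: M_def l_distr)
    show "x \<otimes> r \<in> M" if "x \<in> M" "r \<in> carrier R" for x r
      using that L Lc by (simp add: M_def m_assoc)
  qed
  have "ideal M R"
  proof (rule idealI)
    show "ring R" ..
    show "subgroup M (add_monoid R)"
      using M by (simp add: right_ideal_def additive_subgroup_def)
    show "r \<otimes> x \<in> M" if "x \<in> M" "r \<in> carrier R" for x r
      using that L Lc by (simp add: M_def m_assoc)
    show "x \<otimes> r \<in> M" if "x \<in> M" "r \<in> carrier R" for x r
      using that right_idealD(4)[OF M] by simp
  qed
  moreover have "M \<cdot> M \<subseteq> {\<zero>}"
  proof
    fix w assume "w \<in> M \<cdot> M"
    then show "w \<in> {\<zero>}"
      by induction (auto simp: M_def)
  qed
  ultimately have "M = {\<zero>}"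
    by (rule semiprime)
  moreover have "a \<in> L"
    using assms by (simp add: L_def)
  then have "a \<in> M"
    using a by (auto simp: M_def L_def dest: bspec[of _ _ \<one>])
  ultimately show ?thesis by simp
qed

section \<open>The chain condition on annihilators of single elements\<close>

context right_goldie_ring
begin

text \<open>If every annihilator in the family could be enlarged, iterating the choice
  \<open>f\<close> of a better element would give a strictly increasing chain.\<close>

lemma annihilator_maximal:
  assumes M: "M \<subseteq> carrier R" "M \<noteq> {}"
  shows "\<exists>a\<in>M. \<forall>b\<in>M. right_annihilator R {a} \<subseteq> right_annihilator R {b} \<longrightarrow>
    right_annihilator R {b} = right_annihilator R {a}"
proof (rule ccontr)
  assume "\<not> ?thesis"
  then have "\<forall>a\<in>M. \<exists>b\<in>M. right_annihilator R {a} \<subset> right_annihilator R {b}"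
    by blast
  then obtain f where f: "\<And>a. a \<in> M \<Longrightarrow> f a \<in> M"
      "\<And>a. a \<in> M \<Longrightarrow> right_annihilator R {a} \<subset> right_annihilator R {f a}"
    by metis
  obtain a where a: "a \<in> M" using M(2) by blast
  define S where "S n = {(f ^^ n) a}" for n
  have in_M: "(f ^^ n) a \<in> M" for n
    by (induction n) (auto simp: a f)
  have "\<exists>N. \<forall>n\<ge>N. right_annihilator R (S n) = right_annihilator R (S N)"
  proof (rule acc_right_annihilators)
    show "S n \<subseteq> carrier R" for n
      using in_M M(1) by (auto simp: S_def)
    show "right_annihilator R (S n) \<subseteq> right_annihilator R (S (Suc n))" for n
      using f(2)[OF in_M[of n]] by (auto simp: S_def)
  qed
  then obtain N where "right_annihilator R (S (Suc N)) = right_annihilator R (S N)"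
    by (meson le_Suc_eq order_refl)
  then show False
    using f(2)[OF in_M[of N]] by (simp add: S_def)
qed

text \<open>A Fitting-type property: the right annihilators of the powers of \<open>a\<close>
  increase, and where they stop growing, a power and its square have the same one. The exponent is
  to be positive, so that the power is a multiple of \<open>a\<close>.\<close>

lemma annihilator_pow_stable:
  assumes a: "a \<in> carrier R"
  shows "\<exists>n>0. \<forall>y\<in>carrier R. a [^] n \<otimes> (a [^] n \<otimes> y) = \<zero> \<longrightarrow> a [^] (n::nat) \<otimes> y = \<zero>"
proof -
  have "\<exists>N::nat. \<forall>n\<ge>N. right_annihilator R {a [^] n} = right_annihilator R {a [^] N}"
  proof (rule acc_right_annihilators)
    show "{a [^] n} \<subseteq> carrier R" for n :: nat
      using a by simp
    show "right_annihilator R {a [^] n} \<subseteq> right_annihilator R {a [^] Suc n}" for n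
    proof
      fix y assume "y \<in> right_annihilator R {a [^] n}"
      then have y: "y \<in> carrier R" "a [^] n \<otimes> y = \<zero>" by auto
      have "a [^] Suc n = a \<otimes> a [^] n"
        using a by (metis nat_pow_Suc2)
      then show "y \<in> right_annihilator R {a [^] Suc n}"
        using y a by (simp add: m_assoc del: nat_pow_Suc)
    qed
  qed
  then obtain N :: nat where N: "\<And>n. n \<ge> N \<Longrightarrow> right_annihilator R {a [^] n} = right_annihilator R {a [^] N}"
    by blast
  have "a [^] Suc N \<otimes> y = \<zero>"
    if y: "y \<in> carrier R" "a [^] Suc N \<otimes> (a [^] Suc N \<otimes> y) = \<zero>" for y
  proof -
    have "a [^] (Suc N + Suc N) \<otimes> y = \<zero>"
      using y a by (simp add: nat_pow_mult[symmetric] m_assoc del: nat_pow_Suc add_Suc add_Suc_right)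
    then have "y \<in> right_annihilator R {a [^] (Suc N + Suc N)}"
      using y by (simp del: nat_pow_Suc add_Suc add_Suc_right)
    also have "\<dots> = right_annihilator R {a [^] Suc N}"
      using N[of "Suc N + Suc N"] N[of "Suc N"] by simp
    finally show ?thesis
      by (simp del: nat_pow_Suc)
  qed
  then show ?thesis
    by (intro exI[of _ "Suc N"]) auto
qed

end

section \<open>Nil left ideals, the singular ideal and the Ore condition\<close>

locale semiprime_right_goldie_ring = semiprime_ring R + right_goldie_ring R for R (structure)
begin

text \<open>Among the nonzero multiples of b choose \<open>a\<close> with maximal right annihilator.
  If c = x a is nonzero and c^m is its last nonzero power, then m is at least 1 and c^m lies in R a,
  so by maximality it has the same right annihilator as \<open>a\<close>. That annihilator contains
  c, hence a x a = 0 for every x, and semiprimeness gives a = 0.\<close>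

lemma nil_left_ideal_trivial:
  assumes b: "b \<in> carrier R" and nil: "\<And>x. x \<in> carrier R \<Longrightarrow> \<exists>n::nat. (x \<otimes> b) [^] n = \<zero>"
  shows "b = \<zero>"
proof (rule ccontr)
  assume "b \<noteq> \<zero>"
  define M where "M = {x \<otimes> b | x. x \<in> carrier R} - {\<zero>}"
  have "b \<in> M"
    unfolding M_def using b \<open>b \<noteq> \<zero>\<close> by (auto intro!: exI[of _ \<one>])
  then have "M \<noteq> {}" by blast
  moreover have "M \<subseteq> carrier R"
    using b by (auto simp: M_def)
  ultimately obtain a where a: "a \<in> M" and max: "\<And>c. \<lbrakk>c \<in> M; right_annihilator R {a} \<subseteq> right_annihilator R {c}\<rbrakk> \<Longrightarrow>
      right_annihilator R {c} = right_annihilator R {a}"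
    using annihilator_maximal[of M] by blast
  have ac: "a \<in> carrier R"
    using a b by (auto simp: M_def)
  have Mmult: "x \<otimes> a \<in> M" if "x \<in> carrier R" "x \<otimes> a \<noteq> \<zero>" for x
  proof -
    obtain y where "y \<in> carrier R" "a = y \<otimes> b" using a by (auto simp: M_def)
    then have "x \<otimes> a = (x \<otimes> y) \<otimes> b" "x \<otimes> y \<in> carrier R"
      using that b by (simp_all add: m_assoc)
    then show ?thesis
      using that(2) unfolding M_def by blast
  qed
  have "a \<otimes> x \<otimes> a = \<zero>" if x: "x \<in> carrier R" for x
  proof (cases "x \<otimes> a = \<zero>")
    case True
    then show ?thesis using x ac by (simp add: m_assoc)
  next
    case False
    define c where "c = x \<otimes> a"
    have c: "c \<in> carrier R" using x ac by (simp add: c_def)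
    obtain y where "y \<in> carrier R" "c = y \<otimes> b"
      using Mmult[OF x False] by (auto simp: c_def M_def)
    then have "\<exists>n::nat. c [^] n = \<zero>"
      using nil by simp
    define n where "n = (LEAST n::nat. c [^] n = \<zero>)"
    have n: "c [^] n = \<zero>"
      unfolding n_def by (rule LeastI_ex) fact
    have "n \<noteq> 0"
      using n b \<open>b \<noteq> \<zero>\<close> by (metis l_null l_one nat_pow_0)
    then obtain m where m: "n = Suc m"
      using not0_implies_Suc by blast
    have "m \<noteq> 0"
      using n m c False by (cases m) (auto simp: c_def)
    then obtain k where k: "m = Suc k"
      using not0_implies_Suc by blast
    have "c [^] m \<noteq> \<zero>"
      using not_less_Least[of m "\<lambda>n. c [^] n = \<zero>"] m by (simp add: n_def)
    moreover have eq: "c [^] m = c [^] k \<otimes> x \<otimes> a"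
      using x ac by (simp add: k c_def m_assoc)
    ultimately have "c [^] m \<in> M"
      using Mmult[of "c [^] k \<otimes> x"] x c by simp
    moreover have "right_annihilator R {a} \<subseteq> right_annihilator R {c [^] m}"
      using x c ac unfolding eq by (auto simp: m_assoc)
    ultimately have "right_annihilator R {c [^] m} = right_annihilator R {a}"
      using max by blast
    moreover have "c \<in> right_annihilator R {c [^] m}"
      using n m c by simp
    ultimately have "a \<otimes> c = \<zero>" by auto
    then show ?thesis
      using x ac by (simp add: c_def m_assoc)
  qed
  then have "a = \<zero>"
    using semiprime_element ac by blast
  then show False using a by (simp add: M_def)
qed

text \<open>The right singular ideal vanishes. Each c = x z has a power whose right annihilator
  contains that of z, hence is essential, and yet meets the right ideal generated by this power only
  in zero. So the power is zero and R z is nil.\<close>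

lemma nonsingular:
  assumes z: "z \<in> carrier R" and ess: "essential (right_annihilator R {z})"
  shows "z = \<zero>"
proof (rule nil_left_ideal_trivial[OF z])
  fix x assume x: "x \<in> carrier R"
  define c where "c = x \<otimes> z"
  have c: "c \<in> carrier R" using x z by (simp add: c_def)
  obtain n where n: "n > 0" "\<And>y. \<lbrakk>y \<in> carrier R; c [^] n \<otimes> (c [^] n \<otimes> y) = \<zero>\<rbrakk> \<Longrightarrow> c [^] (n::nat) \<otimes> y = \<zero>"
    using annihilator_pow_stable[OF c] by blast
  have "right_annihilator R {z} \<subseteq> right_annihilator R {c [^] n}"
  proof
    fix y assume "y \<in> right_annihilator R {z}"
    moreover obtain m where "n = Suc m" using n(1) gr0_implies_Suc by blast
    ultimately show "y \<in> right_annihilator R {c [^] n}"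
      using c x z by (simp add: c_def m_assoc)
  qed
  then have "essential (right_annihilator R {c [^] n})"
    using essential_mono ess right_ideal_annihilator[of "{c [^] n}"] c by simp
  then have "c [^] n = \<zero>"
    using n(2) c unfolding essential_def by fastforce
  then show "\<exists>n::nat. (x \<otimes> z) [^] n = \<zero>"
    unfolding c_def by blast
qed

text \<open>Otherwise some nonzero a R meets c R only in zero. Then c^n a R is nonzero, lies in c^n
  R and meets c^(n+1) R only in zero, which makes an infinite direct sum.\<close>

lemma essential_if_left_cancel:
  assumes c: "c \<in> carrier R" and inj: "\<And>y. \<lbrakk>y \<in> carrier R; c \<otimes> y = \<zero>\<rbrakk> \<Longrightarrow> y = \<zero>"
  shows "essential ((\<otimes>) c ` carrier R)"
proof (rule ccontr)
  assume "\<not> ?thesis"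
  then obtain a where a: "a \<in> carrier R" "a \<noteq> \<zero>"
    and no: "\<And>r. \<lbrakk>r \<in> carrier R; a \<otimes> r \<in> (\<otimes>) c ` carrier R\<rbrakk> \<Longrightarrow> a \<otimes> r = \<zero>"
    unfolding essential_def using right_ideal_left_mult_image[OF right_ideal_carrier c] by auto
  define B where "B n = (\<otimes>) (c [^] n) ` carrier R" for n :: nat
  define J where "J n = (\<otimes>) (c [^] n) ` (\<otimes>) a ` carrier R" for n :: nat
  have cancel: "y = \<zero>" if "c [^] n \<otimes> y = \<zero>" "y \<in> carrier R" for n :: nat and y
    using that
  proof (induction n arbitrary: y)
    case (Suc n)
    then have "c [^] n \<otimes> (c \<otimes> y) = \<zero>" using c by (simp add: m_assoc)
    from Suc.IH[OF this] have "c \<otimes> y = \<zero>" using Suc.prems(2) c by simp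
    then show ?case using inj Suc.prems(2) by blast
  qed (use c in simp)
  show False
  proof (rule no_descending_sum[of B J])
    show "right_ideal (B i) R" for i
      unfolding B_def using c by (intro right_ideal_left_mult_image right_ideal_carrier) simp
    show "right_ideal (J i) R" for i
      unfolding J_def using c a by (intro right_ideal_left_mult_image right_ideal_carrier) simp_all
    show "B (Suc i) \<subseteq> B i" for i
      using c by (auto simp: B_def m_assoc)
    show "J i \<subseteq> B i" for i
      using c a by (auto simp: B_def J_def)
    show "J i \<noteq> {\<zero>}" for i
    proof
      assume "J i = {\<zero>}"
      then have "c [^] i \<otimes> (a \<otimes> \<one>) = \<zero>" by (force simp: J_def)
      then show False using cancel[of i a] a c by simp
    qed
    show "J i \<inter> B (Suc i) \<subseteq> {\<zero>}" for i
    proof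
      fix w assume "w \<in> J i \<inter> B (Suc i)"
      then obtain r t where rt: "r \<in> carrier R" "t \<in> carrier R"
          "w = c [^] i \<otimes> (a \<otimes> r)" "w = c [^] Suc i \<otimes> t"
        by (auto simp: J_def B_def)
      then have "c [^] i \<otimes> (a \<otimes> r) = c [^] i \<otimes> (c \<otimes> t)"
        using c by (simp add: m_assoc)
      then have "c [^] i \<otimes> (a \<otimes> r \<ominus> c \<otimes> t) = \<zero>"
        using c a rt by (simp add: a_minus_def r_distr r_minus r_neg)
      then have "a \<otimes> r = c \<otimes> t"
        using cancel[of i "a \<otimes> r \<ominus> c \<otimes> t"] c a rt by (simp add: minus_eq_zero_iff)
      then show "w \<in> {\<zero>}"
        using no[of r] rt c by auto
    qed
  qed
qed

text \<open>If x c = 0, the right annihilator of x contains the essential right ideal c R, so x = 0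
  by \<open>nonsingular\<close>.\<close>

lemma regular_if_left_cancel:
  assumes c: "c \<in> carrier R" and inj: "\<And>y. \<lbrakk>y \<in> carrier R; c \<otimes> y = \<zero>\<rbrakk> \<Longrightarrow> y = \<zero>"
  shows "c \<in> regular_elems R"
proof -
  have "x = \<zero>" if x: "x \<in> carrier R" "x \<otimes> c = \<zero>" for x
  proof (rule nonsingular[OF x(1)])
    have "(\<otimes>) c ` carrier R \<subseteq> right_annihilator R {x}"
      using x c by (auto simp: m_assoc[symmetric])
    then show "essential (right_annihilator R {x})"
      using essential_mono essential_if_left_cancel[OF assms] right_ideal_annihilator[of "{x}"] x
      by simp
  qed
  then show ?thesis
    using assms unfolding regular_elems_def by blast
qed

lemma essential_contains_regular:
  assumes E: "essential E"
  shows "\<exists>c\<in>E. c \<in> regular_elems R"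
proof -
  have E': "right_ideal E R" using E by (simp add: essential_def)
  have ex: "\<exists>a\<in>B. (B \<noteq> {\<zero>} \<longrightarrow> a \<noteq> \<zero>) \<and> (\<forall>y\<in>carrier R. a \<otimes> (a \<otimes> y) = \<zero> \<longrightarrow> a \<otimes> y = \<zero>)"
    if B: "right_ideal B R" for B
  proof (cases "B = {\<zero>}")
    case False
    note B = right_idealD[OF B]
    obtain b where b: "b \<in> B" "b \<noteq> \<zero>" using False B(2) by blast
    have bc: "b \<in> carrier R" using b B by auto
    obtain x where x: "x \<in> carrier R" "\<And>n::nat. (x \<otimes> b) [^] n \<noteq> \<zero>"
      using nil_left_ideal_trivial[OF bc] b by blast
    \<comment> \<open>\<open>nil_left_ideal_trivial\<close> yields an element x b that is not
      nilpotent, whereas an element of the right ideal \<open>B\<close> is wanted. The identity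
      shows that b x is not nilpotent either.\<close>
    have shift: "x \<otimes> (b \<otimes> x) [^] n \<otimes> b = (x \<otimes> b) [^] Suc n" for n :: nat
    proof (induction n)
      case (Suc n)
      have "x \<otimes> (b \<otimes> x) [^] Suc n \<otimes> b = (x \<otimes> (b \<otimes> x) [^] n \<otimes> b) \<otimes> (x \<otimes> b)"
        using x bc by (simp add: m_assoc)
      then show ?case
        using Suc by simp
    qed (use x bc in simp)
    have nz: "(b \<otimes> x) [^] n \<noteq> \<zero>" for n :: nat
      using shift[of n] x(1) x(2)[of "Suc n"] bc by auto
    have bx: "b \<otimes> x \<in> B" "b \<otimes> x \<in> carrier R" using b x B bc by auto
    obtain n where n: "n > 0" "\<forall>y\<in>carrier R. (b \<otimes> x) [^] n \<otimes> ((b \<otimes> x) [^] n \<otimes> y) = \<zero> \<longrightarrow>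
        (b \<otimes> x) [^] (n::nat) \<otimes> y = \<zero>"
      using annihilator_pow_stable[OF bx(2)] by blast
    obtain m where "n = Suc m" using n(1) gr0_implies_Suc by blast
    then have "(b \<otimes> x) [^] n = (b \<otimes> x) \<otimes> (b \<otimes> x) [^] m"
      using bx nat_pow_Suc2 by simp
    then have "(b \<otimes> x) [^] n \<in> B"
      using B(4)[OF bx(1)] bx by simp
    then show ?thesis using n(2) nz by blast
  qed (use right_idealD[OF B] in auto)
  \<comment> \<open>Choosing \<open>a n\<close> in \<open>E\<close>, annihilated by \<open>a 0, \<dots>, a (n - 1)\<close> and with the same annihilator as its
    square, makes the sum of the \<open>a n R\<close> direct, so the choice ends and their sum is left cancellable.\<close>
  define f where "f B = (SOME a. a \<in> B \<and> (B \<noteq> {\<zero>} \<longrightarrow> a \<noteq> \<zero>) \<and>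
    (\<forall>y\<in>carrier R. a \<otimes> (a \<otimes> y) = \<zero> \<longrightarrow> a \<otimes> y = \<zero>))" for B
  have f: "f B \<in> B" "B \<noteq> {\<zero>} \<Longrightarrow> f B \<noteq> \<zero>"
      "\<And>y. \<lbrakk>y \<in> carrier R; f B \<otimes> (f B \<otimes> y) = \<zero>\<rbrakk> \<Longrightarrow> f B \<otimes> y = \<zero>"
    if B: "right_ideal B R" for B
    using someI_ex[OF ex[OF B, unfolded Bex_def], folded f_def] by blast+
  define B where "B n = ((\<lambda>B. B \<inter> right_annihilator R {f B}) ^^ n) E" for n
  have B0: "B 0 = E" and BS: "B (Suc n) = B n \<inter> right_annihilator R {f (B n)}" for n
    by (simp_all add: B_def)
  have B: "right_ideal (B n) R" for n
  proof (induction n)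
    case (Suc n)
    have "f (B n) \<in> carrier R"
      using f(1)[OF Suc] right_idealD(1)[OF Suc] by blast
    then show ?case
      unfolding BS by (intro right_ideal_Int Suc right_ideal_annihilator) simp
  qed (simp add: B0 E')
  define a where "a n = f (B n)" for n
  have a: "a n \<in> B n" "a n \<in> carrier R" for n
    using f(1)[OF B] right_idealD(1)[OF B] by (auto simp: a_def)
  have sq: "a n \<otimes> y = \<zero>" if "y \<in> carrier R" "a n \<otimes> y \<in> B (Suc n)" for n y
    using that f(3)[OF B, of y n] by (simp add: BS a_def)
  have "\<exists>n. B n = {\<zero>}"
  proof (rule ccontr)
    assume nz: "\<not> ?thesis"
    show False
    proof (rule no_descending_sum[of B "\<lambda>n. (\<otimes>) (a n) ` carrier R"])
      show "right_ideal (B i) R" "B (Suc i) \<subseteq> B i" for i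
        using B by (auto simp: BS)
      show "right_ideal ((\<otimes>) (a i) ` carrier R) R" for i
        using a by (intro right_ideal_left_mult_image right_ideal_carrier)
      show "(\<otimes>) (a i) ` carrier R \<noteq> {\<zero>}" for i
      proof
        assume "(\<otimes>) (a i) ` carrier R = {\<zero>}"
        then have "a i \<otimes> \<one> = \<zero>" by blast
        then show False
          using f(2)[OF B, of i] nz a by (simp add: a_def)
      qed
      show "(\<otimes>) (a i) ` carrier R \<subseteq> B i" for i
        using a right_idealD(4)[OF B] by blast
      show "(\<otimes>) (a i) ` carrier R \<inter> B (Suc i) \<subseteq> {\<zero>}" for i
        using sq by blast
    qed
  qed
  then obtain n where n: "B n = {\<zero>}" by blast
  define c where "c = (\<Oplus>i\<in>{..<n}. a i)"
  have dec: "B j \<subseteq> B k" if "k \<le> j" for j k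
    using lift_Suc_antimono_le[of B, OF _ that] by (auto simp: BS)
  have cE: "c \<in> E"
    unfolding c_def using a dec[of 0] B0 by (intro right_ideal_finsum[OF E']) auto
  have cc: "c \<in> carrier R"
    using cE right_idealD(1)[OF E'] by blast
  \<comment> \<open>From c y = 0 comes a relation between the \<open>a i \<otimes> y\<close>;
    \<open>sq\<close> supplies the condition on its single terms.\<close>
  have ann: "a i \<otimes> y = \<zero>" if y: "y \<in> carrier R" "c \<otimes> y = \<zero>" and i: "i < n" for i y
  proof (rule independent_descending[where B = B and n = n and x = "\<lambda>i. a i \<otimes> y"])
    show "right_ideal (B i) R" "B (Suc i) \<subseteq> B i" for i
      using B by (auto simp: BS)
    show "a i \<otimes> y \<in> B i" for i
      using a y right_idealD(4)[OF B] by blast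
    show "a i \<otimes> y = \<zero>" if "a i \<otimes> y \<in> B (Suc i)" for i
      using sq that y by blast
    show "(\<Oplus>i\<in>{..<n}. a i \<otimes> y) = \<zero>"
      using y a finsum_ldistr[of "{..<n}" y a] by (simp add: c_def)
  qed (fact i)
  \<comment> \<open>An element of E killed by \<open>a 0\<close>, ..., \<open>a (n - 1)\<close> lies
    in \<open>B n\<close>, which is zero.\<close>
  have zero: "y = \<zero>" if y: "y \<in> E" "c \<otimes> y = \<zero>" for y
  proof -
    have yc: "y \<in> carrier R" using y right_idealD(1)[OF E'] by blast
    have "y \<in> B k" if "k \<le> n" for k
      using that by (induction k) (use y yc ann in \<open>auto simp: B0 BS a_def[symmetric]\<close>)
    then show ?thesis using n by auto
  qed
  \<comment> \<open>Outside E, essentiality supplies a nonzero multiple of y inside E.\<close>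
  have "y = \<zero>" if y: "y \<in> carrier R" "c \<otimes> y = \<zero>" for y
  proof (rule ccontr)
    assume "y \<noteq> \<zero>"
    then obtain r where r: "r \<in> carrier R" "y \<otimes> r \<in> E" "y \<otimes> r \<noteq> \<zero>"
      using E y by (auto simp: essential_def)
    have "c \<otimes> (y \<otimes> r) = \<zero>"
      using y r cc by (simp add: m_assoc[symmetric])
    then show False using zero r by blast
  qed
  then show ?thesis
    using regular_if_left_cancel[OF cc] cE by blast
qed

text \<open>Since s R is essential, so is its preimage under left multiplication by a, and this
  preimage contains a regular u.\<close>

lemma right_ore:
  assumes a: "a \<in> carrier R" and s: "s \<in> regular_elems R"
  shows "\<exists>u\<in>regular_elems R. \<exists>c\<in>carrier R. a \<otimes> u = s \<otimes> c"
proof -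
  have "essential ((\<otimes>) s ` carrier R)"
    using essential_if_left_cancel regular_elemsD[OF s] by blast
  then have "essential {r \<in> carrier R. a \<otimes> r \<in> (\<otimes>) s ` carrier R}"
    using essential_vimage a by blast
  from essential_contains_regular[OF this] show ?thesis by blast
qed

end

section \<open>Saturated right ideals\<close>

text \<open>The set S is a parameter because the locale serves both for all regular elements of a
  ring and for only the regular constants of a polynomial ring.\<close>

locale right_ore_set = ring R for R (structure) +
  fixes S :: "'a set"
  assumes S_regular: "S \<subseteq> regular_elems R"
    and S_one: "\<one> \<in> S"
    and S_mult: "\<lbrakk>s \<in> S; t \<in> S\<rbrakk> \<Longrightarrow> s \<otimes> t \<in> S"
    and ore: "\<lbrakk>a \<in> carrier R; s \<in> S\<rbrakk> \<Longrightarrow> \<exists>u\<in>S. \<exists>c\<in>carrier R. a \<otimes> u = s \<otimes> c"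
begin

text \<open>The saturated right ideals are the contractions of the right ideals of the localization of \<open>R\<close>
  at \<open>S\<close>.\<close>

definition saturated :: "'a set \<Rightarrow> bool" where
  "saturated I \<longleftrightarrow> right_ideal I R \<and> (\<forall>a\<in>carrier R. \<forall>s\<in>S. a \<otimes> s \<in> I \<longrightarrow> a \<in> I)"

definition saturation :: "'a set \<Rightarrow> 'a set" where
  "saturation I = {a \<in> carrier R. \<exists>s\<in>S. a \<otimes> s \<in> I}"

lemma S_carrier: "s \<in> S \<Longrightarrow> s \<in> carrier R"
  using S_regular regular_elemsD(1) by blast

text \<open>The Ore condition supplies the denominators: s u = t c serves for a sum, and r u = s c
  moves the denominator s past a right factor r.\<close>

lemma saturated_saturation:
  assumes "right_ideal I R"
  shows "saturated (saturation I)"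
proof -
  note I = right_idealD[OF assms]
  have "right_ideal (saturation I) R"
  proof (rule right_idealI)
    show "saturation I \<subseteq> carrier R" by (auto simp: saturation_def)
    show "\<zero> \<in> saturation I"
      using I(2) S_one by (auto simp: saturation_def intro!: bexI[of _ \<one>])
    show "a \<oplus> b \<in> saturation I" if ab: "a \<in> saturation I" "b \<in> saturation I" for a b
    proof -
      obtain s t where st: "a \<in> carrier R" "b \<in> carrier R" "s \<in> S" "t \<in> S" "a \<otimes> s \<in> I" "b \<otimes> t \<in> I"
        using ab by (auto simp: saturation_def)
      obtain u c where uc: "u \<in> S" "c \<in> carrier R" "s \<otimes> u = t \<otimes> c"
        using ore[of s t] st S_carrier by blast
      have "a \<otimes> (s \<otimes> u) \<in> I" "b \<otimes> (t \<otimes> c) \<in> I"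
        using I(4)[OF st(5), of u] I(4)[OF st(6), of c] st uc S_carrier by (simp_all add: m_assoc)
      then have "(a \<oplus> b) \<otimes> (s \<otimes> u) \<in> I"
        using I(3) st uc S_carrier by (simp add: l_distr)
      then show ?thesis
        using st(1,2) S_mult[OF st(3) uc(1)] by (auto simp: saturation_def simp del: uc(3))
    qed
    show "a \<otimes> r \<in> saturation I" if ar: "a \<in> saturation I" "r \<in> carrier R" for a r
    proof -
      obtain s where s: "a \<in> carrier R" "s \<in> S" "a \<otimes> s \<in> I"
        using ar by (auto simp: saturation_def)
      obtain u c where uc: "u \<in> S" "c \<in> carrier R" "r \<otimes> u = s \<otimes> c"
        using ore[of r s] s ar by blast
      have "a \<otimes> r \<otimes> u = a \<otimes> s \<otimes> c"
        using s uc ar S_carrier by (simp add: m_assoc)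
      then have "a \<otimes> r \<otimes> u \<in> I"
        using I(4)[OF s(3) uc(2)] by simp
      then show ?thesis
        using s uc ar by (auto simp: saturation_def)
    qed
  qed
  moreover have "a \<in> saturation I" if "a \<in> carrier R" "s \<in> S" "a \<otimes> s \<in> saturation I" for a s
    using that S_carrier S_mult by (auto simp: saturation_def m_assoc)
  ultimately show ?thesis
    by (simp add: saturated_def)
qed

lemma saturatedD:
  assumes "saturated I"
  shows "right_ideal I R" "\<lbrakk>a \<in> carrier R; s \<in> S; a \<otimes> s \<in> I\<rbrakk> \<Longrightarrow> a \<in> I"
  using assms by (auto simp: saturated_def)

lemma saturation_mono: "I \<subseteq> J \<Longrightarrow> saturation I \<subseteq> saturation J"
  by (auto simp: saturation_def)

lemma saturation_superset:
  assumes "I \<subseteq> carrier R"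
  shows "I \<subseteq> saturation I"
  using assms S_one by (force simp: saturation_def)

lemma saturated_annihilator:
  assumes "X \<subseteq> carrier R"
  shows "saturated (right_annihilator R X)"
proof -
  have "x \<otimes> a = \<zero>" if "a \<in> carrier R" "s \<in> S" "x \<in> X" "x \<otimes> (a \<otimes> s) = \<zero>" for a s x
    using that assms S_carrier S_regular regular_elemsD(3)[of s "x \<otimes> a"]
    by (auto simp: m_assoc subset_iff)
  then show ?thesis
    unfolding saturated_def using right_ideal_annihilator[OF assms]
    by (auto simp: right_annihilator_def)
qed

text \<open>Centrality turns the set into a preimage under left multiplication by l, hence into a
  right ideal, and it lets denominators pass l.\<close>

lemma saturated_central_vimage:
  assumes I: "saturated I" and l: "l \<in> carrier R"
    and central: "\<And>p. p \<in> carrier R \<Longrightarrow> p \<otimes> l = l \<otimes> p"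
  shows "saturated {p \<in> carrier R. p \<otimes> l \<in> I}"
proof -
  have "{p \<in> carrier R. p \<otimes> l \<in> I} = {p \<in> carrier R. l \<otimes> p \<in> I}"
    using central by auto
  then have "right_ideal {p \<in> carrier R. p \<otimes> l \<in> I} R"
    using right_ideal_left_mult_vimage[OF saturatedD(1)[OF I] l] by simp
  moreover have "p \<otimes> l \<in> I" if "p \<in> carrier R" "s \<in> S" "p \<otimes> s \<otimes> l \<in> I" for p s
  proof -
    have "p \<otimes> s \<otimes> l = p \<otimes> l \<otimes> s"
      using that l central[of s] S_carrier by (simp add: m_assoc)
    then show ?thesis
      using saturatedD(2)[OF I, of "p \<otimes> l" s] that l by simp
  qed
  ultimately show ?thesis
    by (auto simp: saturated_def)
qed

end

text \<open>A single repetition is asked, which is easier to verify than eventual constancy; the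
  latter follows by applying \<open>acc\<close> to subchains.\<close>

locale right_ore_set_acc = right_ore_set +
  assumes acc: "\<lbrakk>\<And>n::nat. saturated (I n); \<And>n. I n \<subseteq> I (Suc n)\<rbrakk> \<Longrightarrow> \<exists>n. I (Suc n) = I n"
begin

lemma saturated_stabilizes:
  assumes "\<And>n::nat. saturated (I n)" and mono: "\<And>n. I n \<subseteq> I (Suc n)"
  shows "\<exists>N. \<forall>n\<ge>N. I n = I N"
proof (rule chain_stabilizes)
  fix g :: "nat \<Rightarrow> nat" assume g: "strict_mono g"
  show "\<exists>n. I (g (Suc n)) = I (g n)"
  proof (rule acc)
    show "I (g n) \<subseteq> I (g (Suc n))" for n
      using lift_Suc_mono_le[of I, OF mono] g by (simp add: strict_mono_less_eq)
  qed (rule assms)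
qed

lemma right_goldie: "right_goldie_ring R"
proof
  show "\<exists>N. \<forall>n\<ge>N. right_annihilator R (X n) = right_annihilator R (X N)"
    if "\<And>n. X n \<subseteq> carrier R" "\<And>n. right_annihilator R (X n) \<subseteq> right_annihilator R (X (Suc n))"
    for X :: "nat \<Rightarrow> 'a set"
    using that by (intro saturated_stabilizes saturated_annihilator)
  show "\<not> independent_family R I"
    if I: "\<And>n. right_ideal (I n) R" and nz: "\<And>n. I n \<noteq> {\<zero>}" for I
  proof
    assume ind: "independent_family R I"
    have Ic: "I n \<subseteq> carrier R" for n
      by (rule right_idealD(1)[OF I])
    \<comment> \<open>\<open>B n\<close> is \<open>I 0 + ... + I (n - 1)\<close>. Each x is a total
      family, so its value at n does not affect the sum and may be reset below.\<close>
    define B where "B n = {(\<Oplus>i\<in>{..<n}. x i) | x. \<forall>i. x i \<in> I i}" for n :: nat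
    have BI: "(\<Oplus>i\<in>{..<n}. x i) \<in> B n" if "\<And>i. x i \<in> I i" for n x
      using that unfolding B_def by blast
    have B: "right_ideal (B n) R" for n
    proof (rule right_idealI)
      show "B n \<subseteq> carrier R"
        using Ic by (auto simp: B_def intro!: finsum_closed)
      have "(\<Oplus>i\<in>{..<n}. \<zero>) \<in> B n"
        by (rule BI) (rule right_idealD(2)[OF I])
      then show "\<zero> \<in> B n" by simp
      show "a \<oplus> b \<in> B n" if ab: "a \<in> B n" "b \<in> B n" for a b
      proof -
        obtain x y where xy: "\<And>i. x i \<in> I i" "\<And>i. y i \<in> I i"
          "a = (\<Oplus>i\<in>{..<n}. x i)" "b = (\<Oplus>i\<in>{..<n}. y i)"
          using ab by (auto simp: B_def)
        have "x \<in> {..<n} \<rightarrow> carrier R" "y \<in> {..<n} \<rightarrow> carrier R"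
          using xy Ic by auto
        then have "a \<oplus> b = (\<Oplus>i\<in>{..<n}. x i \<oplus> y i)"
          unfolding xy by (simp add: finsum_addf)
        then show ?thesis
          using BI[of "\<lambda>i. x i \<oplus> y i" n] xy right_idealD(3)[OF I] by simp
      qed
      show "a \<otimes> r \<in> B n" if ar: "a \<in> B n" "r \<in> carrier R" for a r
      proof -
        obtain x where x: "\<And>i. x i \<in> I i" "a = (\<Oplus>i\<in>{..<n}. x i)"
          using ar by (auto simp: B_def)
        have "x \<in> {..<n} \<rightarrow> carrier R"
          using x Ic by auto
        then have "a \<otimes> r = (\<Oplus>i\<in>{..<n}. x i \<otimes> r)"
          unfolding x using ar by (simp add: finsum_ldistr)
        then show ?thesis
          using BI[of "\<lambda>i. x i \<otimes> r" n] x ar right_idealD(4)[OF I] by simp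
      qed
    qed
    have split: "(\<Oplus>i\<in>{..<Suc n}. x i) = x n \<oplus> (\<Oplus>i\<in>{..<n}. x i)"
      if "\<And>i. i \<le> n \<Longrightarrow> x i \<in> carrier R" for n x
      using that by (subst lessThan_Suc, subst finsum_insert) (auto simp: Pi_def)
    have mono: "B n \<subseteq> B (Suc n)" for n
    proof
      fix a assume "a \<in> B n"
      then obtain x where x: "\<And>i. x i \<in> I i" "a = (\<Oplus>i\<in>{..<n}. x i)"
        by (auto simp: B_def)
      define y where "y = x(n := \<zero>)"
      have y: "y i \<in> I i" for i
        using x right_idealD(2)[OF I] by (simp add: y_def)
      have "(\<Oplus>i\<in>{..<n}. y i) = a"
        unfolding x(2) using x Ic by (intro finsum_cong') (auto simp: y_def)
      then have "(\<Oplus>i\<in>{..<Suc n}. y i) = a"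
        using y Ic \<open>a \<in> B n\<close> right_idealD(1)[OF B[of n]] split[of n y] fun_upd_same[of x n \<zero>]
        unfolding y_def[symmetric] by (auto simp: subset_iff)
      then show "a \<in> B (Suc n)"
        using BI[of y "Suc n"] y by simp
    qed
    \<comment> \<open>The partial sums themselves may grow forever, but their saturations repeat. So
      a nonzero f in \<open>I n\<close> has a multiple f s in the sum of the earlier right
      ideals.\<close>
    obtain n where n: "saturation (B (Suc n)) = saturation (B n)"
      using acc[of "\<lambda>n. saturation (B n)"] saturated_saturation[OF B] saturation_mono[OF mono]
      by blast
    obtain f where f: "f \<in> I n" "f \<noteq> \<zero>"
      using nz[of n] right_idealD(2)[OF I[of n]] by blast
    have fc: "f \<in> carrier R" using f Ic by blast
    define y where "y i = (if i = n then f else \<zero>)" for i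
    have "(\<Oplus>i\<in>{..<n}. y i) = (\<Oplus>i\<in>{..<n}. \<zero>)"
      by (intro finsum_cong') (auto simp: y_def)
    then have "(\<Oplus>i\<in>{..<Suc n}. y i) = f"
      using split[of n y] fc by (simp add: y_def)
    then have "f \<in> B (Suc n)"
      using BI[of y "Suc n"] f right_idealD(2)[OF I] by (auto simp: y_def)
    then have "f \<in> saturation (B n)"
      using n saturation_superset[OF right_idealD(1)[OF B[of "Suc n"]]] by blast
    then obtain s x where s: "s \<in> S" "f \<otimes> s = (\<Oplus>i\<in>{..<n}. x i)" and x: "\<And>i. x i \<in> I i"
      by (auto simp: saturation_def B_def)
    have fs: "f \<otimes> s \<in> I n"
      using right_idealD(4)[OF I f(1)] S_carrier[OF s(1)] by blast
    \<comment> \<open>The negative of f s at index n completes a vanishing sum of n + 1 terms.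
      Independence forces f s = 0, against the regularity of s.\<close>
    define z where "z = x(n := \<ominus> (f \<otimes> s))"
    have z: "z i \<in> I i" for i
      using x fs right_idealD(5)[OF I] by (simp add: z_def)
    have "(\<Oplus>i\<in>{..<n}. z i) = f \<otimes> s"
      unfolding s(2) using x Ic by (intro finsum_cong') (auto simp: z_def)
    moreover have "z i \<in> carrier R" for i
      using z Ic by blast
    ultimately have "(\<Oplus>i\<in>{..<Suc n}. z i) = z n \<oplus> f \<otimes> s"
      using split[of n z] by simp
    moreover have "z n = \<ominus> (f \<otimes> s)" "f \<otimes> s \<in> carrier R"
      using fc S_carrier[OF s(1)] by (simp_all only: z_def fun_upd_same m_closed)
    ultimately have "(\<Oplus>i\<in>{..<Suc n}. z i) = \<zero>"
      by (simp add: l_neg)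
    then have "z n = \<zero>"
      using ind z unfolding independent_family_def by blast
    then have "f \<otimes> s = \<zero>"
      using \<open>z n = \<ominus> (f \<otimes> s)\<close> \<open>f \<otimes> s \<in> carrier R\<close> by (metis minus_minus minus_zero)
    then show False
      using regular_elemsD(3)[of s f] s S_regular fc f by blast
  qed
qed

end

text \<open>Take a in \<open>I (Suc n)\<close> outside \<open>I n\<close>. By saturation the right
  ideal of all r with a r in \<open>I n\<close> contains no regular element, so it is not essential,
  and some nonzero b R meets it only in zero. Then a b R is nonzero, lies in
  \<open>I (Suc n)\<close> and meets \<open>I n\<close> only in zero. A strictly increasing chain
  would thus give an infinite direct sum.\<close>

sublocale semiprime_right_goldie_ring \<subseteq> right_ore_set_acc R "regular_elems R"
proof unfold_locales
  fix I :: "nat \<Rightarrow> 'a set"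
  interpret right_ore_set R "regular_elems R"
    by unfold_locales (auto simp: one_regular regular_mult right_ore)
  assume sat: "\<And>n. saturated (I n)" and mono: "\<And>n. I n \<subseteq> I (Suc n)"
  show "\<exists>n. I (Suc n) = I n"
  proof (rule ccontr)
    assume neq: "\<not> ?thesis"
    have I: "right_ideal (I n) R" for n
      by (rule saturatedD(1)[OF sat])
    have "\<exists>a\<in>I (Suc n). a \<noteq> \<zero> \<and> (\<forall>r\<in>carrier R. a \<otimes> r \<in> I n \<longrightarrow> a \<otimes> r = \<zero>)" for n
    proof -
      obtain a where a: "a \<in> I (Suc n)" "a \<notin> I n"
        using mono neq by blast
      then have ac: "a \<in> carrier R"
        using right_idealD(1)[OF I] by blast
      define E where "E = {r \<in> carrier R. a \<otimes> r \<in> I n}"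
      have "\<not> essential E"
        using essential_contains_regular[of E] saturatedD(2)[OF sat ac] a by (auto simp: E_def)
      then obtain b where b: "b \<in> carrier R" "b \<noteq> \<zero>"
          "\<And>r. \<lbrakk>r \<in> carrier R; b \<otimes> r \<in> E\<rbrakk> \<Longrightarrow> b \<otimes> r = \<zero>"
        using right_ideal_left_mult_vimage[OF I ac] unfolding essential_def E_def by blast
      have "a \<otimes> b \<noteq> \<zero>"
      proof
        assume "a \<otimes> b = \<zero>"
        then have "b \<otimes> \<one> \<in> E"
          using b right_idealD(2)[OF I] by (simp add: E_def)
        then show False using b(3)[of \<one>] b(1,2) by simp
      qed
      moreover have "a \<otimes> b \<in> I (Suc n)"
        using right_idealD(4)[OF I a(1)] b by simp
      moreover have "a \<otimes> b \<otimes> r = \<zero>" if "r \<in> carrier R" "a \<otimes> b \<otimes> r \<in> I n" for r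
      proof -
        have "b \<otimes> r = \<zero>"
          using b(3)[of r] that b(1) ac by (simp add: E_def m_assoc)
        then show ?thesis
          using that b(1) ac by (simp add: m_assoc)
      qed
      ultimately show ?thesis by blast
    qed
    then obtain a where a: "\<And>n. a n \<in> I (Suc n)" "\<And>n. a n \<noteq> \<zero>"
        "\<And>n r. \<lbrakk>r \<in> carrier R; a n \<otimes> r \<in> I n\<rbrakk> \<Longrightarrow> a n \<otimes> r = \<zero>"
      by metis
    have ac: "a n \<in> carrier R" for n
      using a(1) right_idealD(1)[OF I] by blast
    show False
    proof (rule no_ascending_sum[of I "\<lambda>n. (\<otimes>) (a n) ` carrier R"])
      show "(\<otimes>) (a i) ` carrier R \<noteq> {\<zero>}" for i
      proof
        assume "(\<otimes>) (a i) ` carrier R = {\<zero>}"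
        then have "a i \<otimes> \<one> = \<zero>" by blast
        then show False using a ac by simp
      qed
      show "(\<otimes>) (a i) ` carrier R \<subseteq> I (Suc i)" for i
        using a(1) right_idealD(4)[OF I] by blast
      show "(\<otimes>) (a i) ` carrier R \<inter> I i \<subseteq> {\<zero>}" for i
        using a(3) by blast
    qed (use I mono ac in \<open>auto intro: right_ideal_left_mult_image right_ideal_carrier\<close>)
  qed
qed (auto simp: one_regular regular_mult right_ore)

section \<open>Polynomials over a semiprime right Goldie ring\<close>

context UP_ring
begin

lemma coeff_monom_mult:
  assumes "a \<in> carrier R" "p \<in> carrier P"
  shows "coeff P (monom P a k \<otimes>\<^bsub>P\<^esub> p) n = (if k \<le> n then a \<otimes> coeff P p (n - k) else \<zero>)"
proof -
  have "coeff P (monom P a k \<otimes>\<^bsub>P\<^esub> p) n =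
      (\<Oplus>i\<in>{..n}. if k = i then a \<otimes> coeff P p (n - i) else \<zero>)"
    unfolding coeff_mult[OF monom_closed[OF assms(1)] assms(2)] using assms
    by (intro R.finsum_cong') auto
  also have "\<dots> = (if k \<le> n then a \<otimes> coeff P p (n - k) else \<zero>)"
  proof (cases "k \<le> n")
    case True
    then show ?thesis
      using R.finsum_singleton[of k "{..n}" "\<lambda>i. a \<otimes> coeff P p (n - i)"] assms by simp
  next
    case False
    then have "(\<Oplus>i\<in>{..n}. if k = i then a \<otimes> coeff P p (n - i) else \<zero>) = (\<Oplus>i\<in>{..n}. \<zero>)"
      by (intro R.finsum_cong') auto
    then show ?thesis using False by simp
  qed
  finally show ?thesis .
qed

lemma coeff_mult_monom:
  assumes "a \<in> carrier R" "p \<in> carrier P"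
  shows "coeff P (p \<otimes>\<^bsub>P\<^esub> monom P a k) n = (if k \<le> n then coeff P p (n - k) \<otimes> a else \<zero>)"
proof (cases "k \<le> n")
  case True
  have "coeff P p i \<otimes> coeff P (monom P a k) (n - i) =
      (if n - k = i then coeff P p i \<otimes> a else \<zero>)" if "i \<le> n" for i
    using that True assms by (cases "n - k = i") auto
  then have "coeff P (p \<otimes>\<^bsub>P\<^esub> monom P a k) n =
      (\<Oplus>i\<in>{..n}. if n - k = i then coeff P p i \<otimes> a else \<zero>)"
    unfolding coeff_mult[OF assms(2) monom_closed[OF assms(1)]] using assms
    by (intro R.finsum_cong') auto
  then show ?thesis
    using R.finsum_singleton[of "n - k" "{..n}" "\<lambda>i. coeff P p i \<otimes> a"] assms True by simp
next
  case False
  then have "coeff P (p \<otimes>\<^bsub>P\<^esub> monom P a k) n = (\<Oplus>i\<in>{..n}. \<zero>)"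
    unfolding coeff_mult[OF assms(2) monom_closed[OF assms(1)]] using assms
    by (intro R.finsum_cong') auto
  then show ?thesis using False by simp
qed

lemma monom_0_mult:
  "\<lbrakk>a \<in> carrier R; b \<in> carrier R\<rbrakk> \<Longrightarrow> monom P a n \<otimes>\<^bsub>P\<^esub> monom P b 0 = monom P (a \<otimes> b) n"
  "\<lbrakk>a \<in> carrier R; b \<in> carrier R\<rbrakk> \<Longrightarrow> monom P b 0 \<otimes>\<^bsub>P\<^esub> monom P a n = monom P (b \<otimes> a) n"
  using monom_mult[of a b n 0] monom_mult[of b a 0 n] by simp_all

text \<open>Bounds m and n replace the degrees, because the degree of a product with a constant can
  drop when there are zero divisors.\<close>

lemma coeff_mult_top:
  assumes "p \<in> carrier P" "q \<in> carrier P"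
    and "\<And>i. i > m \<Longrightarrow> coeff P p i = \<zero>" "\<And>i. i > n \<Longrightarrow> coeff P q i = \<zero>"
  shows "coeff P (p \<otimes>\<^bsub>P\<^esub> q) (m + n) = coeff P p m \<otimes> coeff P q n"
proof -
  have "coeff P p i \<otimes> coeff P q (m + n - i) = \<zero>" if "i \<noteq> m" for i
    using that assms by (cases "i < m") auto
  then have "coeff P (p \<otimes>\<^bsub>P\<^esub> q) (m + n) =
      (\<Oplus>i\<in>{..m + n}. if m = i then coeff P p i \<otimes> coeff P q (m + n - i) else \<zero>)"
    unfolding coeff_mult[OF assms(1,2)] using assms(1,2) by (intro R.finsum_cong') auto
  then show ?thesis
    using R.finsum_singleton[of m "{..m + n}" "\<lambda>i. coeff P p i \<otimes> coeff P q (m + n - i)"] assms(1,2)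
    by simp
qed

lemma poly_induct [consumes 1, case_names monom add]:
  assumes p: "p \<in> carrier P"
    and monom: "\<And>a n. a \<in> carrier R \<Longrightarrow> Q (monom P a n)"
    and add: "\<And>p q. \<lbrakk>p \<in> carrier P; q \<in> carrier P; Q p; Q q\<rbrakk> \<Longrightarrow> Q (p \<oplus>\<^bsub>P\<^esub> q)"
  shows "Q p"
proof -
  have "Q p" if "p \<in> carrier P" "\<forall>k\<ge>n. coeff P p k = \<zero>" for n p
    using that
  proof (induction n arbitrary: p)
    case 0
    then have "p = monom P \<zero> 0"
      by (intro up_eqI) auto
    then show ?case using monom[of \<zero> 0] by simp
  next
    case (Suc n)
    define q where "q = p \<ominus>\<^bsub>P\<^esub> monom P (coeff P p n) n"
    have q: "q \<in> carrier P" using Suc.prems by (simp add: q_def)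
    have "coeff P q k = \<zero>" if "k \<ge> n" for k
      using that Suc.prems by (cases "k = n") (auto simp: q_def P.minus_eq R.r_neg)
    then have "Q q" using Suc.IH q by blast
    moreover have "p = q \<oplus>\<^bsub>P\<^esub> monom P (coeff P p n) n"
      using Suc.prems by (simp add: q_def P.minus_eq P.a_assoc P.l_neg)
    moreover have "Q (q \<oplus>\<^bsub>P\<^esub> monom P (coeff P p n) n)"
      by (rule add) (use q \<open>Q q\<close> monom Suc.prems in auto)
    ultimately show ?case by simp
  qed
  moreover have "\<forall>k\<ge>Suc (deg R p). coeff P p k = \<zero>"
    using deg_aboveD p by simp
  ultimately show ?thesis using p by blast
qed

text \<open>If f lies in an ideal of square zero and has leading coefficient \<open>a\<close>, then
  f b f = 0 for every constant b, and its top coefficient is a b a. So a = 0 by semiprimeness of the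
  coefficient ring.\<close>

lemma semiprime_UP:
  assumes "semiprime_ring R"
  shows "semiprime_ring P"
proof
  fix I assume I: "ideal I P" and I2: "I \<cdot>\<^bsub>P\<^esub> I \<subseteq> {\<zero>\<^bsub>P\<^esub>}"
  interpret S: semiprime_ring R by fact
  interpret I: ideal I P by fact
  have "f = \<zero>\<^bsub>P\<^esub>" if f: "f \<in> I" for f
  proof (rule ccontr)
    assume "f \<noteq> \<zero>\<^bsub>P\<^esub>"
    have fc: "f \<in> carrier P" using f by simp
    define a where "a = coeff P f (deg R f)"
    have a: "a \<in> carrier R" using fc by (simp add: a_def)
    have "a \<otimes> b \<otimes> a = \<zero>" if b: "b \<in> carrier R" for b
    proof -
      have "f \<otimes>\<^bsub>P\<^esub> monom P b 0 \<otimes>\<^bsub>P\<^esub> f \<in> I \<cdot>\<^bsub>P\<^esub> I"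
        using f b by (intro ideal_prod.prod I.I_r_closed) auto
      then have "coeff P (f \<otimes>\<^bsub>P\<^esub> monom P b 0 \<otimes>\<^bsub>P\<^esub> f) (deg R f + deg R f) = \<zero>"
        using I2 by auto
      then show ?thesis
        using fc b deg_aboveD[OF _ fc]
        by (subst (asm) coeff_mult_top) (auto simp: coeff_mult_monom a_def simp del: coeff_mult)
    qed
    then have "a = \<zero>" using S.semiprime_element a by blast
    then show False
      using lcoeff_nonzero[OF \<open>f \<noteq> \<zero>\<^bsub>P\<^esub>\<close> fc] by (simp add: a_def)
  qed
  then show "I = {\<zero>\<^bsub>P\<^esub>}"
    using I.zero_closed by blast
qed

text \<open>The coefficient at k may itself be zero, so polynomials of lower degree contribute and
  zero needs no separate clause.\<close>

definition leading :: "nat \<Rightarrow> (nat \<Rightarrow> 'a) set \<Rightarrow> 'a set" where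
  "leading k I = {coeff P f k | f. f \<in> I \<and> (\<forall>j>k. coeff P f j = \<zero>)}"

lemma right_ideal_leading:
  assumes "right_ideal I P"
  shows "right_ideal (leading k I) R"
proof (rule R.right_idealI)
  note I = P.right_idealD[OF assms]
  have c: "f \<in> carrier P" if "f \<in> I" for f using that I(1) by blast
  show "leading k I \<subseteq> carrier R"
    using c by (auto simp: leading_def)
  show "\<zero> \<in> leading k I"
    unfolding leading_def using I(2) by (auto intro!: exI[of _ "\<zero>\<^bsub>P\<^esub>"])
  show "a \<oplus> b \<in> leading k I" if ab: "a \<in> leading k I" "b \<in> leading k I" for a b
  proof -
    obtain f g where "f \<in> I" "g \<in> I" "a = coeff P f k" "b = coeff P g k"
      "\<forall>j>k. coeff P f j = \<zero>" "\<forall>j>k. coeff P g j = \<zero>"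
      using ab by (auto simp: leading_def)
    then show ?thesis
      unfolding leading_def using c I(3) by (auto intro!: exI[of _ "f \<oplus>\<^bsub>P\<^esub> g"])
  qed
  show "a \<otimes> r \<in> leading k I" if ar: "a \<in> leading k I" "r \<in> carrier R" for a r
  proof -
    obtain f where "f \<in> I" "a = coeff P f k" "\<forall>j>k. coeff P f j = \<zero>"
      using ar by (auto simp: leading_def)
    then show ?thesis
      unfolding leading_def using c I(4) ar
      by (auto simp: coeff_mult_monom simp del: coeff_mult intro!: exI[of _ "f \<otimes>\<^bsub>P\<^esub> monom P r 0"])
  qed
qed

lemma leading_mono: "I \<subseteq> J \<Longrightarrow> leading k I \<subseteq> leading k J"
  by (auto simp: leading_def)

text \<open>Multiplication by x shifts the coefficients by one.\<close>

lemma leading_Suc: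
  assumes "right_ideal I P"
  shows "leading k I \<subseteq> leading (Suc k) I"
proof
  note I = P.right_idealD[OF assms]
  fix a assume "a \<in> leading k I"
  then obtain f where f: "f \<in> I" "a = coeff P f k" "\<forall>j>k. coeff P f j = \<zero>"
    by (auto simp: leading_def)
  moreover have "f \<in> carrier P" using f I(1) by blast
  ultimately show "a \<in> leading (Suc k) I"
    unfolding leading_def using I(4)
    by (auto simp: coeff_mult_monom simp del: coeff_mult intro!: exI[of _ "f \<otimes>\<^bsub>P\<^esub> monom P \<one> 1"])
qed

end

section \<open>The Ore set of regular constants and its chain condition\<close>

locale poly_semiprime_right_goldie = UP R P + R?: semiprime_right_goldie_ring R
  for R (structure) and P (structure)

sublocale poly_semiprime_right_goldie \<subseteq> UP_ring
  by unfold_locales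

context poly_semiprime_right_goldie
begin

abbreviation const_regular :: "(nat \<Rightarrow> 'a) set" where
  "const_regular \<equiv> (\<lambda>s. monom P s 0) ` regular_elems R"

text \<open>For a monomial this is \<open>right_ore\<close> applied to its coefficient. For a sum,
  the multipliers u and v of the summands receive a common right multiple u w = v e; as w is
  regular, so is u w.\<close>

lemma const_ore:
  assumes "p \<in> carrier P" "s \<in> regular_elems R"
  shows "\<exists>u\<in>regular_elems R. \<exists>c\<in>carrier P. p \<otimes>\<^bsub>P\<^esub> monom P u 0 = monom P s 0 \<otimes>\<^bsub>P\<^esub> c"
  using assms
proof (induction rule: poly_induct)
  case (monom a n)
  then obtain u c where "u \<in> regular_elems R" "c \<in> carrier R" "a \<otimes> u = s \<otimes> c"
    using right_ore by blast
  then show ?case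
    using monom R.regular_elemsD(1)
    by (intro bexI[of _ u] bexI[of _ "monom P c n"]) (auto simp: monom_0_mult simp del: monom_mult)
next
  case (add p q)
  obtain u c where u: "u \<in> regular_elems R" "c \<in> carrier P"
      "p \<otimes>\<^bsub>P\<^esub> monom P u 0 = monom P s 0 \<otimes>\<^bsub>P\<^esub> c"
    using add by blast
  obtain v d where v: "v \<in> regular_elems R" "d \<in> carrier P"
      "q \<otimes>\<^bsub>P\<^esub> monom P v 0 = monom P s 0 \<otimes>\<^bsub>P\<^esub> d"
    using add by blast
  obtain w e where w: "w \<in> regular_elems R" "e \<in> carrier R" "u \<otimes> w = v \<otimes> e"
    using right_ore[of u v] u v R.regular_elemsD(1) by blast
  have c: "u \<in> carrier R" "v \<in> carrier R" "w \<in> carrier R" "s \<in> carrier R"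
    using u v w add R.regular_elemsD(1) by auto
  have "p \<otimes>\<^bsub>P\<^esub> monom P (u \<otimes> w) 0 = p \<otimes>\<^bsub>P\<^esub> monom P u 0 \<otimes>\<^bsub>P\<^esub> monom P w 0"
    using c add(1) by (simp add: monom_0_mult[symmetric] P.m_assoc del: monom_mult)
  moreover have "q \<otimes>\<^bsub>P\<^esub> monom P (u \<otimes> w) 0 = q \<otimes>\<^bsub>P\<^esub> monom P v 0 \<otimes>\<^bsub>P\<^esub> monom P e 0"
    using c w add(2) by (simp add: monom_0_mult[symmetric] P.m_assoc del: monom_mult)
  ultimately have "(p \<oplus>\<^bsub>P\<^esub> q) \<otimes>\<^bsub>P\<^esub> monom P (u \<otimes> w) 0 =
      monom P s 0 \<otimes>\<^bsub>P\<^esub> (c \<otimes>\<^bsub>P\<^esub> monom P w 0 \<oplus>\<^bsub>P\<^esub> d \<otimes>\<^bsub>P\<^esub> monom P e 0)"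
    using u v w c add(1,2) by (simp add: P.l_distr P.r_distr P.m_assoc del: monom_mult)
  then show ?case
    using u v w c R.regular_mult[OF u(1) w(1)]
    by (intro bexI[of _ "u \<otimes> w"] bexI[of _ "c \<otimes>\<^bsub>P\<^esub> monom P w 0 \<oplus>\<^bsub>P\<^esub> d \<otimes>\<^bsub>P\<^esub> monom P e 0"]) auto
qed

lemma const_regular: "const_regular \<subseteq> regular_elems P"
proof
  fix t assume "t \<in> const_regular"
  then obtain s where s: "s \<in> regular_elems R" "t = monom P s 0" by blast
  note sD = R.regular_elemsD[OF s(1)]
  have "f = \<zero>\<^bsub>P\<^esub>" if f: "f \<in> carrier P" "t \<otimes>\<^bsub>P\<^esub> f = \<zero>\<^bsub>P\<^esub>" for f
  proof (rule up_eqI)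
    show "coeff P f n = coeff P \<zero>\<^bsub>P\<^esub> n" for n
      using f coeff_monom_mult[OF sD(1) f(1), of 0 n] sD(2)[of "coeff P f n"] s by (simp del: coeff_mult)
  qed (use f in auto)
  moreover have "f = \<zero>\<^bsub>P\<^esub>" if f: "f \<in> carrier P" "f \<otimes>\<^bsub>P\<^esub> t = \<zero>\<^bsub>P\<^esub>" for f
  proof (rule up_eqI)
    show "coeff P f n = coeff P \<zero>\<^bsub>P\<^esub> n" for n
      using f coeff_mult_monom[OF sD(1) f(1), of 0 n] sD(3)[of "coeff P f n"] s by (simp del: coeff_mult)
  qed (use f in auto)
  moreover have "t \<in> carrier P"
    using s(2) sD(1) by simp
  ultimately show "t \<in> regular_elems P"
    unfolding regular_elems_def by blast
qed

end

sublocale poly_semiprime_right_goldie \<subseteq> PS: right_ore_set P "const_regular"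
proof unfold_locales
  show "const_regular \<subseteq> regular_elems P" by (rule const_regular)
  show "\<one>\<^bsub>P\<^esub> \<in> const_regular"
    using monom_one R.one_regular by (intro image_eqI[of _ _ \<one>]) auto
  show "s \<otimes>\<^bsub>P\<^esub> t \<in> const_regular" if "s \<in> const_regular" "t \<in> const_regular" for s t
    using that R.regular_mult R.regular_elemsD(1) by (auto simp: monom_0_mult simp del: monom_mult)
  show "\<exists>u\<in>const_regular. \<exists>c\<in>carrier P. a \<otimes>\<^bsub>P\<^esub> u = s \<otimes>\<^bsub>P\<^esub> c"
    if "a \<in> carrier P" "s \<in> const_regular" for a s
    using const_ore[OF that(1)] that(2) by auto
qed

context poly_semiprime_right_goldie
begin

text \<open>Hilbert's basis argument, applied to the saturations in \<open>R\<close> of the right ideals of leading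
  coefficients.\<close>

lemma acc_poly:
  assumes sat: "\<And>n::nat. PS.saturated (I n)" and mono: "\<And>n. I n \<subseteq> I (Suc n)"
  shows "\<exists>n. I (Suc n) = I n"
proof -
  have I: "right_ideal (I n) P" for n
    by (rule PS.saturatedD(1)[OF sat])
  note ID = P.right_idealD[OF I]
  define L where "L k n = saturation (leading k (I n))" for k n
  have L: "saturated (L k n)" for k n
    unfolding L_def by (intro saturated_saturation right_ideal_leading I)
  have L_Suc1: "L k n \<subseteq> L (Suc k) n" and L_Suc2: "L k n \<subseteq> L k (Suc n)" for k n
    unfolding L_def by (intro saturation_mono leading_Suc leading_mono I mono)+
  have L_mono: "L k n \<subseteq> L k' n'" if "k \<le> k'" "n \<le> n'" for k n k' n'
    using lift_Suc_mono_le[of "\<lambda>k. L k n", OF L_Suc1 that(1)]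
      lift_Suc_mono_le[of "\<lambda>n. L k' n", OF L_Suc2 that(2)] by blast
  \<comment> \<open>The diagonal chain settles all degrees k from N on at once, since
    \<open>L\<close> is monotone in the degree and in the stage. The finitely many smaller degrees
    are treated one by one.\<close>
  have "\<exists>N. \<forall>n\<ge>N. L n n = L N N"
    using saturated_stabilizes[of "\<lambda>n. L n n"] L L_mono[of n "Suc n" n "Suc n" for n] by simp
  then obtain N where N: "L n n = L N N" if "n \<ge> N" for n
    by blast
  have "\<forall>k. \<exists>M. \<forall>n\<ge>M. L k n = L k M"
    using saturated_stabilizes[of "L k" for k] L L_Suc2 by simp
  then obtain M where M: "L k n = L k (M k)" if "n \<ge> M k" for k n
    by metis
  \<comment> \<open>The sum is merely a bound above N and above each of the finitely many
    \<open>M k\<close>.\<close>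
  define m where "m = N + (\<Sum>k<N. M k)"
  have m: "L k (Suc m) = L k m" for k
  proof (cases "k < N")
    case True
    then have "M k \<le> (\<Sum>k<N. M k)"
      by (intro member_le_sum) auto
    then show ?thesis
      using M[of k m] M[of k "Suc m"] by (simp add: m_def)
  next
    case False
    have "L k (Suc m) \<subseteq> L (k + Suc m) (k + Suc m)"
      by (rule L_mono) auto
    also have "\<dots> = L N N"
      by (rule N) (simp add: m_def)
    also have "\<dots> \<subseteq> L k m"
      by (rule L_mono) (use False in \<open>auto simp: m_def\<close>)
    finally show ?thesis using L_mono[of k k m "Suc m"] by auto
  qed
  have "f \<in> I m" if "f \<in> I (Suc m)" "\<forall>j\<ge>d. coeff P f j = \<zero>" for d f
    using that
  proof (induction d arbitrary: f)
    case 0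
    then have "f = \<zero>\<^bsub>P\<^esub>"
      using ID(1) by (intro up_eqI) auto
    then show ?case using ID(2) by simp
  next
    case (Suc d)
    have f: "f \<in> carrier P" using Suc.prems(1) ID(1) by blast
    have "coeff P f d \<in> leading d (I (Suc m))"
      using Suc.prems by (auto simp: leading_def Suc_le_eq)
    then have "coeff P f d \<in> L d m"
      unfolding m[symmetric] unfolding L_def
      using saturation_superset[OF R.right_idealD(1)[OF right_ideal_leading[OF I]]] by blast
    then obtain s g where s: "s \<in> regular_elems R" and g: "g \<in> I m"
        "coeff P f d \<otimes> s = coeff P g d" "\<forall>j>d. coeff P g j = \<zero>"
      by (auto simp: L_def saturation_def leading_def)
    have gc: "g \<in> carrier P" using g(1) ID(1) by blast
    have sc: "s \<in> carrier R" using R.regular_elemsD(1) s by blast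
    \<comment> \<open>After multiplication by the denominator s, the coefficient of f at d is
      cancelled by g. The induction hypothesis puts f s = h + g into \<open>I m\<close>, and
      saturation removes s.\<close>
    define h where "h = f \<otimes>\<^bsub>P\<^esub> monom P s 0 \<ominus>\<^bsub>P\<^esub> g"
    have fs: "f \<otimes>\<^bsub>P\<^esub> monom P s 0 \<in> carrier P" using f sc by simp
    have "h \<in> I (Suc m)"
      unfolding h_def using Suc.prems(1) g(1) mono[of m] sc
      by (intro ID(6) ID(4)) auto
    moreover have "coeff P h j = \<zero>" if "j \<ge> d" for j
    proof -
      have "coeff P h j = coeff P f j \<otimes> s \<ominus> coeff P g j"
        using f sc gc by (simp add: h_def P.minus_eq R.minus_eq coeff_mult_monom del: coeff_mult)
      then show ?thesis
        using that g Suc.prems(2) gc sc by (cases "j = d") (auto simp: R.minus_eq R.r_neg)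
    qed
    ultimately have "h \<in> I m" using Suc.IH by blast
    then have "h \<oplus>\<^bsub>P\<^esub> g \<in> I m" using ID(3) g(1) by blast
    moreover have "h \<oplus>\<^bsub>P\<^esub> g = f \<otimes>\<^bsub>P\<^esub> monom P s 0"
      using fs gc by (simp add: h_def P.minus_eq P.a_assoc P.l_neg)
    ultimately show ?case
      using PS.saturatedD(2)[OF sat f, of "monom P s 0"] s by auto
  qed
  moreover have "\<forall>j\<ge>Suc (deg R f). coeff P f j = \<zero>" if "f \<in> I (Suc m)" for f
    using ID(1) that by (auto intro!: deg_aboveD)
  ultimately have "I (Suc m) = I m"
    using mono by blast
  then show ?thesis ..
qed

end

sublocale poly_semiprime_right_goldie \<subseteq> PS: right_ore_set_acc P "const_regular"
  by unfold_locales (rule acc_poly)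

sublocale poly_semiprime_right_goldie \<subseteq> PG: semiprime_right_goldie_ring P
  using PS.right_goldie semiprime_UP[OF semiprime_ring_axioms]
  by (intro semiprime_right_goldie_ring.intro)

section \<open>Evaluation at central elements\<close>

context UP_ring
begin

definition central :: "'a \<Rightarrow> bool" where
  "central z \<longleftrightarrow> z \<in> carrier R \<and> (\<forall>a\<in>carrier R. a \<otimes> z = z \<otimes> a)"

text \<open>\<open>lin z\<close> is \<open>x - z\<close>, and the value of a polynomial at \<open>z\<close> is its remainder modulo \<open>x - z\<close>.\<close>

definition lin :: "'a \<Rightarrow> nat \<Rightarrow> 'a" where
  "lin z = monom P \<one> 1 \<ominus>\<^bsub>P\<^esub> monom P z 0"

definition evalp :: "'a \<Rightarrow> (nat \<Rightarrow> 'a) \<Rightarrow> 'a" where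
  "evalp z p = (THE a. a \<in> carrier R \<and> (\<exists>q\<in>carrier P. p = lin z \<otimes>\<^bsub>P\<^esub> q \<oplus>\<^bsub>P\<^esub> monom P a 0))"

lemma centralD:
  assumes "central z"
  shows "z \<in> carrier R" "a \<in> carrier R \<Longrightarrow> a \<otimes> z = z \<otimes> a"
  using assms by (auto simp: central_def)

lemma const_central:
  assumes z: "central z" and p: "p \<in> carrier P"
  shows "p \<otimes>\<^bsub>P\<^esub> monom P z 0 = monom P z 0 \<otimes>\<^bsub>P\<^esub> p"
  using centralD[OF z] p
  by (intro up_eqI) (simp_all add: coeff_monom_mult coeff_mult_monom del: coeff_mult)

lemma lin_closed [simp]: "z \<in> carrier R \<Longrightarrow> lin z \<in> carrier P"
  by (simp add: lin_def)

lemma lin_central: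
  assumes z: "central z" and p: "p \<in> carrier P"
  shows "p \<otimes>\<^bsub>P\<^esub> lin z = lin z \<otimes>\<^bsub>P\<^esub> p"
proof -
  have "p \<otimes>\<^bsub>P\<^esub> monom P \<one> 1 = monom P \<one> 1 \<otimes>\<^bsub>P\<^esub> p"
    using p by (intro up_eqI) (simp_all add: coeff_monom_mult coeff_mult_monom del: coeff_mult)
  then show ?thesis
    using centralD(1)[OF z] p const_central[OF assms]
    by (simp add: lin_def P.minus_eq P.l_distr P.r_distr P.r_minus P.l_minus)
qed

text \<open>Comparing coefficients gives q_n = z q_(n+1), so the coefficients of q vanish from above
  the degree down to 0, and with q_0 the constant - z q_0 vanishes. This makes remainders modulo x -
  z unique.\<close>

lemma lin_mult_eq_const:
  assumes z: "z \<in> carrier R" and q: "q \<in> carrier P" and a: "a \<in> carrier R"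
    and eq: "lin z \<otimes>\<^bsub>P\<^esub> q = monom P a 0"
  shows "a = \<zero>"
proof -
  have lin: "lin z \<otimes>\<^bsub>P\<^esub> q = monom P \<one> 1 \<otimes>\<^bsub>P\<^esub> q \<ominus>\<^bsub>P\<^esub> monom P z 0 \<otimes>\<^bsub>P\<^esub> q"
    using z q by (simp add: lin_def P.minus_eq P.l_distr P.l_minus)
  have c: "coeff P (lin z \<otimes>\<^bsub>P\<^esub> q) n = (if 1 \<le> n then coeff P q (n - 1) else \<zero>) \<ominus> z \<otimes> coeff P q n"
    for n
    unfolding lin using z q
    by (simp add: coeff_monom_mult P.minus_eq R.minus_eq del: coeff_mult)
  have step: "coeff P q n = z \<otimes> coeff P q (Suc n)" for n
  proof -
    have "coeff P q n \<ominus> z \<otimes> coeff P q (Suc n) = \<zero>"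
      using c[of "Suc n"] a by (simp add: eq)
    then show ?thesis
      using z q by (simp add: R.minus_eq_zero_iff)
  qed
  have "coeff P q (n - k) = \<zero>" if "n > deg R q" "k \<le> n" for n k
    using that(2)
  proof (induction k)
    case 0
    then show ?case using that(1) q deg_aboveD by simp
  next
    case (Suc k)
    then have "Suc (n - Suc k) = n - k" by simp
    then show ?case
      using step[of "n - Suc k"] Suc z by simp
  qed
  from this[of "Suc (deg R q)" "Suc (deg R q)"] have "coeff P q 0 = \<zero>" by simp
  then show ?thesis
    using c[of 0] a z by (simp add: eq R.minus_eq)
qed

text \<open>Two decompositions of p give (x - z)(q - r) = b - a, a constant multiple of x -
  z.\<close>

lemma evalpI:
  assumes z: "z \<in> carrier R" and a: "a \<in> carrier R" and q: "q \<in> carrier P"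
    and p: "p = lin z \<otimes>\<^bsub>P\<^esub> q \<oplus>\<^bsub>P\<^esub> monom P a 0"
  shows "evalp z p = a"
  unfolding evalp_def
proof (rule the_equality)
  show "a \<in> carrier R \<and> (\<exists>q\<in>carrier P. p = lin z \<otimes>\<^bsub>P\<^esub> q \<oplus>\<^bsub>P\<^esub> monom P a 0)"
    using assms by blast
  fix b assume "b \<in> carrier R \<and> (\<exists>q\<in>carrier P. p = lin z \<otimes>\<^bsub>P\<^esub> q \<oplus>\<^bsub>P\<^esub> monom P b 0)"
  then obtain r where b: "b \<in> carrier R" "r \<in> carrier P" "p = lin z \<otimes>\<^bsub>P\<^esub> r \<oplus>\<^bsub>P\<^esub> monom P b 0"
    by blast
  have cancel: "u \<ominus>\<^bsub>P\<^esub> v = x \<ominus>\<^bsub>P\<^esub> y" if "u \<oplus>\<^bsub>P\<^esub> y = v \<oplus>\<^bsub>P\<^esub> x" "u \<in> carrier P" "v \<in> carrier P"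
      "x \<in> carrier P" "y \<in> carrier P" for u v x y
  proof -
    have "u = v \<oplus>\<^bsub>P\<^esub> x \<ominus>\<^bsub>P\<^esub> y"
      using that(2-) unfolding that(1)[symmetric] by (simp add: P.minus_eq P.a_assoc P.r_neg)
    then have "u = (x \<ominus>\<^bsub>P\<^esub> y) \<oplus>\<^bsub>P\<^esub> v"
      using that(2-) by (simp add: P.minus_eq P.a_ac)
    then show ?thesis
      using that(2-) by (simp add: P.minus_eq P.a_assoc P.r_neg)
  qed
  have "lin z \<otimes>\<^bsub>P\<^esub> (q \<ominus>\<^bsub>P\<^esub> r) = lin z \<otimes>\<^bsub>P\<^esub> q \<ominus>\<^bsub>P\<^esub> lin z \<otimes>\<^bsub>P\<^esub> r"
    using z q b by (simp add: P.minus_eq P.r_distr P.r_minus)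
  also have "\<dots> = monom P b 0 \<ominus>\<^bsub>P\<^esub> monom P a 0"
    using p b z q a by (intro cancel) auto
  also have "\<dots> = monom P (b \<ominus> a) 0"
    using a b by (simp add: P.minus_eq R.minus_eq)
  finally have "b \<ominus> a = \<zero>"
    using z q a b by (intro lin_mult_eq_const[of z "q \<ominus>\<^bsub>P\<^esub> r"]) auto
  then show "b = a"
    using a b by (simp add: R.minus_eq_zero_iff)
qed

text \<open>One division step reads a x^(n+1) = (x - z) a x^n + z a x^n.\<close>

lemma monom_division:
  assumes z: "z \<in> carrier R" and a: "a \<in> carrier R"
  shows "\<exists>q\<in>carrier P. \<exists>b\<in>carrier R. monom P a n = lin z \<otimes>\<^bsub>P\<^esub> q \<oplus>\<^bsub>P\<^esub> monom P b 0"
  using a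
proof (induction n arbitrary: a)
  case 0
  then show ?case using z by (intro bexI[of _ "\<zero>\<^bsub>P\<^esub>"] bexI[of _ a]) auto
next
  case (Suc n)
  obtain q b where q: "q \<in> carrier P" "b \<in> carrier R"
      "monom P (z \<otimes> a) n = lin z \<otimes>\<^bsub>P\<^esub> q \<oplus>\<^bsub>P\<^esub> monom P b 0"
    using Suc.IH[of "z \<otimes> a"] Suc.prems z by blast
  have "monom P a (Suc n) = monom P \<one> 1 \<otimes>\<^bsub>P\<^esub> monom P a n"
    using monom_mult[of \<one> a 1 n] Suc.prems by simp
  moreover have "monom P (z \<otimes> a) n = monom P z 0 \<otimes>\<^bsub>P\<^esub> monom P a n"
    using monom_mult[of z a 0 n] Suc.prems z by simp
  ultimately have "monom P a (Suc n) = lin z \<otimes>\<^bsub>P\<^esub> monom P a n \<oplus>\<^bsub>P\<^esub> monom P (z \<otimes> a) n"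
    using Suc.prems z by (simp add: lin_def P.minus_eq P.l_distr P.l_minus P.a_assoc P.l_neg del: monom_mult)
  also have "\<dots> = lin z \<otimes>\<^bsub>P\<^esub> (monom P a n \<oplus>\<^bsub>P\<^esub> q) \<oplus>\<^bsub>P\<^esub> monom P b 0"
    unfolding q(3) using q(1,2) Suc.prems z by (simp add: P.r_distr P.a_assoc)
  finally show ?case
    using q(1,2) Suc.prems by (intro bexI[of _ "monom P a n \<oplus>\<^bsub>P\<^esub> q"] bexI[of _ b]) auto
qed

lemma poly_division:
  assumes z: "z \<in> carrier R" and p: "p \<in> carrier P"
  shows "\<exists>q\<in>carrier P. \<exists>b\<in>carrier R. p = lin z \<otimes>\<^bsub>P\<^esub> q \<oplus>\<^bsub>P\<^esub> monom P b 0"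
  using p
proof (induction rule: poly_induct)
  case (monom a n)
  then show ?case by (rule monom_division[OF z])
next
  case (add p p')
  then obtain q b q' b' where "q \<in> carrier P" "b \<in> carrier R" "p = lin z \<otimes>\<^bsub>P\<^esub> q \<oplus>\<^bsub>P\<^esub> monom P b 0"
      "q' \<in> carrier P" "b' \<in> carrier R" "p' = lin z \<otimes>\<^bsub>P\<^esub> q' \<oplus>\<^bsub>P\<^esub> monom P b' 0"
    by blast
  then show ?case
    using z by (intro bexI[of _ "q \<oplus>\<^bsub>P\<^esub> q'"] bexI[of _ "b \<oplus> b'"]) (auto simp: P.r_distr P.a_ac)
qed

lemma evalp:
  assumes z: "z \<in> carrier R" and p: "p \<in> carrier P"
  shows "evalp z p \<in> carrier R" "\<exists>q\<in>carrier P. p = lin z \<otimes>\<^bsub>P\<^esub> q \<oplus>\<^bsub>P\<^esub> monom P (evalp z p) 0"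
proof -
  obtain q b where q: "q \<in> carrier P" "b \<in> carrier R" "p = lin z \<otimes>\<^bsub>P\<^esub> q \<oplus>\<^bsub>P\<^esub> monom P b 0"
    using poly_division[OF assms] by blast
  then have "evalp z p = b"
    using evalpI z by blast
  then show "evalp z p \<in> carrier R" "\<exists>q\<in>carrier P. p = lin z \<otimes>\<^bsub>P\<^esub> q \<oplus>\<^bsub>P\<^esub> monom P (evalp z p) 0"
    using q by auto
qed

lemma evalp_const: "\<lbrakk>z \<in> carrier R; a \<in> carrier R\<rbrakk> \<Longrightarrow> evalp z (monom P a 0) = a"
  by (rule evalpI[where q = "\<zero>\<^bsub>P\<^esub>"]) auto

text \<open>With remainders a and b, the product is p (x - z) q' + (x - z) q b + a b. Centrality of
  z moves x - z to the left of p, so a b is the remainder.\<close>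

lemma evalp_hom:
  assumes z: "central z"
  shows "evalp z \<in> ring_hom P R"
proof (rule ring_hom_memI)
  note zc = centralD(1)[OF z]
  show "evalp z p \<in> carrier R" if "p \<in> carrier P" for p
    using evalp zc that by blast
  show "evalp z \<one>\<^bsub>P\<^esub> = \<one>"
    using evalp_const[OF zc R.one_closed] by simp
  fix p p' assume pp: "p \<in> carrier P" "p' \<in> carrier P"
  define a b where "a = evalp z p" and "b = evalp z p'"
  have ab: "a \<in> carrier R" "b \<in> carrier R"
    using evalp zc pp by (auto simp: a_def b_def)
  obtain q q' where q: "q \<in> carrier P" "p = lin z \<otimes>\<^bsub>P\<^esub> q \<oplus>\<^bsub>P\<^esub> monom P a 0"
      "q' \<in> carrier P" "p' = lin z \<otimes>\<^bsub>P\<^esub> q' \<oplus>\<^bsub>P\<^esub> monom P b 0"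
    using evalp(2)[OF zc] pp by (metis a_def b_def)
  show "evalp z (p \<oplus>\<^bsub>P\<^esub> p') = evalp z p \<oplus> evalp z p'"
    unfolding a_def[symmetric] b_def[symmetric]
    by (rule evalpI[where q = "q \<oplus>\<^bsub>P\<^esub> q'"]) (use q(1,3) ab zc in \<open>auto simp: q(2,4) P.r_distr P.a_ac\<close>)
  have "p \<otimes>\<^bsub>P\<^esub> p' = p \<otimes>\<^bsub>P\<^esub> (lin z \<otimes>\<^bsub>P\<^esub> q') \<oplus>\<^bsub>P\<^esub> p \<otimes>\<^bsub>P\<^esub> monom P b 0"
    using pp(1) q(1,3) ab zc by (simp add: q(4) P.r_distr)
  also have "p \<otimes>\<^bsub>P\<^esub> (lin z \<otimes>\<^bsub>P\<^esub> q') = lin z \<otimes>\<^bsub>P\<^esub> (p \<otimes>\<^bsub>P\<^esub> q')"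
    using pp(1) q(3) zc lin_central[OF z pp(1)] by (simp add: P.m_assoc[symmetric])
  also have "p \<otimes>\<^bsub>P\<^esub> monom P b 0 = lin z \<otimes>\<^bsub>P\<^esub> (q \<otimes>\<^bsub>P\<^esub> monom P b 0) \<oplus>\<^bsub>P\<^esub> monom P (a \<otimes> b) 0"
    using q(1) ab zc monom_mult[of a b 0 0]
    by (simp add: q(2) P.l_distr P.m_assoc del: monom_mult)
  finally have "p \<otimes>\<^bsub>P\<^esub> p' =
      lin z \<otimes>\<^bsub>P\<^esub> (p \<otimes>\<^bsub>P\<^esub> q' \<oplus>\<^bsub>P\<^esub> q \<otimes>\<^bsub>P\<^esub> monom P b 0) \<oplus>\<^bsub>P\<^esub> monom P (a \<otimes> b) 0"
    using pp(1) q(1,3) ab zc by (simp add: P.r_distr P.a_assoc del: monom_mult)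
  then show "evalp z (p \<otimes>\<^bsub>P\<^esub> p') = evalp z p \<otimes> evalp z p'"
    unfolding a_def[symmetric] b_def[symmetric] using pp(1) q(1,3) ab zc
    by (intro evalpI[where q = "p \<otimes>\<^bsub>P\<^esub> q' \<oplus>\<^bsub>P\<^esub> q \<otimes>\<^bsub>P\<^esub> monom P b 0"]) auto
qed

end

context poly_semiprime_right_goldie
begin

text \<open>A sequence is what the chain condition consumes. For the scalars of a field the lemma
  says that only finitely many of them send f to an element that is not regular.\<close>

lemma eval_eventually_regular:
  fixes z :: "nat \<Rightarrow> 'a"
  assumes f: "f \<in> regular_elems P"
    and z: "\<And>n. central (z n)"
    and unit: "\<And>m n. m \<noteq> n \<Longrightarrow> z m \<ominus> z n \<in> Units R"
  shows "\<exists>n. evalp (z n) f \<in> regular_elems R"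
proof (rule ccontr)
  assume neg: "\<not> ?thesis"
  note fD = P.regular_elemsD[OF f]
  note zc = centralD(1)[OF z]
  \<comment> \<open>The right ideal generated by f is saturated so that \<open>PS.acc\<close>
    becomes applicable; modulo \<open>F\<close> one works as in \<open>(Fract R)[x]\<close> modulo
    f.\<close>
  define F where "F = PS.saturation ((\<otimes>\<^bsub>P\<^esub>) f ` carrier P)"
  have F: "PS.saturated F"
    unfolding F_def
    by (intro PS.saturated_saturation P.right_ideal_left_mult_image P.right_ideal_carrier fD(1))
  have fF: "f \<otimes>\<^bsub>P\<^esub> p \<in> F" if "p \<in> carrier P" for p
    unfolding F_def using that fD(1) by (intro subsetD[OF PS.saturation_superset]) auto
  have ex: "\<exists>g. g \<in> carrier P \<and> g \<notin> F \<and> g \<otimes>\<^bsub>P\<^esub> lin (z n) \<in> F" for n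
  proof -
    define e where "e = evalp (z n) f"
    obtain q where q: "q \<in> carrier P" "f = lin (z n) \<otimes>\<^bsub>P\<^esub> q \<oplus>\<^bsub>P\<^esub> monom P e 0"
      using evalp(2)[OF zc fD(1)] unfolding e_def by blast
    have e: "e \<in> carrier R"
      using evalp(1)[OF zc fD(1)] by (simp add: e_def)
    \<comment> \<open>By \<open>regular_if_left_cancel\<close>, an element that is not regular has a
      nonzero right annihilator; the left one need not be considered.\<close>
    obtain b where b: "b \<in> carrier R" "e \<otimes> b = \<zero>" "b \<noteq> \<zero>"
      using neg R.regular_if_left_cancel[OF e] by (auto simp: e_def)
    define g where "g = q \<otimes>\<^bsub>P\<^esub> monom P b 0"
    have g: "g \<in> carrier P" using q b by (simp add: g_def)
    have "monom P e 0 \<otimes>\<^bsub>P\<^esub> monom P b 0 = \<zero>\<^bsub>P\<^esub>"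
      using monom_0_mult(1)[of e b 0] e b by simp
    then have fb: "f \<otimes>\<^bsub>P\<^esub> monom P b 0 = lin (z n) \<otimes>\<^bsub>P\<^esub> g"
      unfolding q(2) g_def using q(1) b(1) e zc by (simp add: P.l_distr P.m_assoc del: monom_mult)
    \<comment> \<open>If g s = f h, then f b s = (x - z) f h = f (x - z) h. Cancelling f makes the
      constant b s a multiple of x - z, so b s = 0, which is impossible for regular s and nonzero
      b.\<close>
    have "g \<notin> F"
    proof
      assume "g \<in> F"
      then obtain s h where s: "s \<in> regular_elems R" and h: "h \<in> carrier P"
          "g \<otimes>\<^bsub>P\<^esub> monom P s 0 = f \<otimes>\<^bsub>P\<^esub> h"
        by (auto simp: F_def PS.saturation_def)
      have sc: "s \<in> carrier R" using s R.regular_elemsD(1) by blast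
      have "f \<otimes>\<^bsub>P\<^esub> monom P (b \<otimes> s) 0 = f \<otimes>\<^bsub>P\<^esub> monom P b 0 \<otimes>\<^bsub>P\<^esub> monom P s 0"
        using fD(1) b sc monom_0_mult(1)[of b s 0] by (simp add: P.m_assoc del: monom_mult)
      also have "\<dots> = lin (z n) \<otimes>\<^bsub>P\<^esub> (f \<otimes>\<^bsub>P\<^esub> h)"
        unfolding fb h(2)[symmetric] using g sc zc by (simp add: P.m_assoc)
      also have "\<dots> = f \<otimes>\<^bsub>P\<^esub> (lin (z n) \<otimes>\<^bsub>P\<^esub> h)"
        using lin_central[OF z fD(1)] fD(1) h(1) zc by (simp add: P.m_assoc[symmetric])
      finally have "f \<otimes>\<^bsub>P\<^esub> (lin (z n) \<otimes>\<^bsub>P\<^esub> h \<ominus>\<^bsub>P\<^esub> monom P (b \<otimes> s) 0) = \<zero>\<^bsub>P\<^esub>"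
        using fD(1) h(1) zc b sc by (simp add: P.minus_eq P.r_distr P.r_minus P.r_neg del: monom_mult)
      then have "lin (z n) \<otimes>\<^bsub>P\<^esub> h = monom P (b \<otimes> s) 0"
        using fD(2)[of "lin (z n) \<otimes>\<^bsub>P\<^esub> h \<ominus>\<^bsub>P\<^esub> monom P (b \<otimes> s) 0"] h(1) zc b sc
        by (simp add: P.minus_eq_zero_iff del: monom_mult)
      then have "b \<otimes> s = \<zero>"
        using lin_mult_eq_const[OF zc h(1)] b sc by blast
      then show False
        using R.regular_elemsD(3)[OF s b(1)] b(3) by blast
    qed
    moreover have "g \<otimes>\<^bsub>P\<^esub> lin (z n) \<in> F"
      using fF[of "monom P b 0"] b(1) lin_central[OF z g] by (simp add: fb)
    ultimately show ?thesis using g by blast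
  qed
  \<comment> \<open>Modulo \<open>F\<close>, the right ideal \<open>J n\<close> is the sum of the eigenspaces of \<open>x\<close> for \<open>z 0, \<dots>, z (n - 1)\<close>.\<close>
  define J where "J = rec_nat F (\<lambda>n I. {p \<in> carrier P. p \<otimes>\<^bsub>P\<^esub> lin (z n) \<in> I})"
  have J0: "J 0 = F" and JS: "J (Suc n) = {p \<in> carrier P. p \<otimes>\<^bsub>P\<^esub> lin (z n) \<in> J n}" for n
    by (simp_all add: J_def)
  have J: "PS.saturated (J n)" for n
  proof (induction n)
    case (Suc n)
    show ?case
      unfolding JS by (intro PS.saturated_central_vimage Suc lin_central z lin_closed zc)
  qed (simp add: J0 F)
  note JD = P.right_idealD[OF PS.saturatedD(1)[OF J]]
  have mono: "J n \<subseteq> J (Suc n)" for n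
    unfolding JS using JD(1,4) zc by auto
  \<comment> \<open>At a repetition an eigenvector g for \<open>z n\<close>, which lies in
    \<open>J (Suc n)\<close>, already lies in \<open>J n\<close>; independence of the eigenspaces is
    to contradict this.\<close>
  obtain n where n: "J (Suc n) = J n"
    using PS.acc[of J] J mono by blast
  obtain g where g: "g \<in> carrier P" "g \<notin> F" "g \<otimes>\<^bsub>P\<^esub> lin (z n) \<in> F"
    using ex by blast
  have FJ: "F \<subseteq> J k" for k
    using lift_Suc_mono_le[of J 0 k, OF mono] by (simp add: J0)
  have "g \<in> J (Suc n)"
    unfolding JS using g FJ by blast
  then have "g \<in> J n"
    using n by blast
  \<comment> \<open>If g (x - \<open>z k\<close>) lies in \<open>J k\<close>, so does its difference
    with g (x - \<open>z n\<close>), which is g times the unit \<open>z n - z k\<close>. Hence g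
    lies in \<open>J k\<close>, one stage lower.\<close>
  moreover have "g \<notin> J k" if "k \<le> n" for k
    using that
  proof (induction k)
    case (Suc k)
    show ?case
    proof
      assume "g \<in> J (Suc k)"
      then have "g \<otimes>\<^bsub>P\<^esub> lin (z k) \<in> J k" by (simp add: JS)
      moreover have "g \<otimes>\<^bsub>P\<^esub> lin (z n) \<in> J k" using g FJ by blast
      ultimately have "g \<otimes>\<^bsub>P\<^esub> lin (z k) \<ominus>\<^bsub>P\<^esub> g \<otimes>\<^bsub>P\<^esub> lin (z n) \<in> J k"
        by (rule JD(6))
      moreover have "lin (z k) \<ominus>\<^bsub>P\<^esub> lin (z n) = monom P (z n \<ominus> z k) 0"
        using zc by (intro up_eqI)
          (auto simp: lin_def P.minus_eq R.minus_eq R.a_ac R.r_neg R.minus_add del: monom_mult)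
      then have "g \<otimes>\<^bsub>P\<^esub> lin (z k) \<ominus>\<^bsub>P\<^esub> g \<otimes>\<^bsub>P\<^esub> lin (z n) = g \<otimes>\<^bsub>P\<^esub> monom P (z n \<ominus> z k) 0"
        using g(1) zc by (simp add: P.minus_eq P.r_distr P.r_minus flip: \<open>lin (z k) \<ominus>\<^bsub>P\<^esub> lin (z n) = monom P (z n \<ominus> z k) 0\<close>)
      ultimately have *: "g \<otimes>\<^bsub>P\<^esub> monom P (z n \<ominus> z k) 0 \<in> J k" by simp
      have u: "z n \<ominus> z k \<in> Units R"
        using unit[of n k] Suc.prems by simp
      then have w: "z n \<ominus> z k \<in> carrier R" "inv (z n \<ominus> z k) \<in> carrier R" by auto
      have "g \<otimes>\<^bsub>P\<^esub> monom P (z n \<ominus> z k) 0 \<otimes>\<^bsub>P\<^esub> monom P (inv (z n \<ominus> z k)) 0 = g"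
        using g(1) w u monom_0_mult(1)[OF w, of 0] by (simp add: P.m_assoc R.Units_r_inv del: monom_mult)
      then have "g \<in> J k"
        using JD(4)[OF *, of "monom P (inv (z n \<ominus> z k)) 0"] w by simp
      then show False using Suc by simp
    qed
  qed (simp add: J0 g)
  ultimately show False by blast
qed

end

section \<open>The monoid of right fractions\<close>

text \<open>Fractions are multiplied here but not added: commutators of units involve only the
  multiplicative monoid.\<close>

locale right_ore_ring = right_ore_set R "regular_elems R" for R (structure)
begin

lemma regular_left_cancel:
  assumes "s \<in> regular_elems R" "x \<in> carrier R" "y \<in> carrier R" "s \<otimes> x = s \<otimes> y"
  shows "x = y"
proof -
  have "s \<otimes> (x \<ominus> y) = \<zero>"
    using assms regular_elemsD(1) by (simp add: minus_eq r_distr r_minus r_neg)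
  then show ?thesis
    using assms regular_elemsD(2)[of s "x \<ominus> y"] by (simp add: minus_eq_zero_iff)
qed

lemma regular_right_cancel:
  assumes "s \<in> regular_elems R" "x \<in> carrier R" "y \<in> carrier R" "x \<otimes> s = y \<otimes> s"
  shows "x = y"
proof -
  have "(x \<ominus> y) \<otimes> s = \<zero>"
    using assms regular_elemsD(1) by (simp add: minus_eq l_distr l_minus r_neg)
  then show ?thesis
    using assms regular_elemsD(3)[of s "x \<ominus> y"] by (simp add: minus_eq_zero_iff)
qed

text \<open>Cancellation on the right comes from the Ore condition for s and s c: from s u = s c e
  follows u = c e, so y c = 0 implies y u = 0 with u regular.\<close>

lemma regular_right_factor:
  assumes s: "s \<in> regular_elems R" and c: "c \<in> carrier R" and sc: "s \<otimes> c \<in> regular_elems R"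
  shows "c \<in> regular_elems R"
proof -
  have sR: "s \<in> carrier R" by (rule regular_elemsD(1)[OF s])
  have "y = \<zero>" if y: "y \<in> carrier R" "c \<otimes> y = \<zero>" for y
    using regular_elemsD(2)[OF sc, of y] y c sR by (simp add: m_assoc)
  moreover have "y = \<zero>" if y: "y \<in> carrier R" "y \<otimes> c = \<zero>" for y
  proof -
    obtain u e where u: "u \<in> regular_elems R" "e \<in> carrier R" "s \<otimes> u = s \<otimes> c \<otimes> e"
      using ore[OF sR sc] by blast
    have uR: "u \<in> carrier R" by (rule regular_elemsD(1)[OF u(1)])
    have "u = c \<otimes> e"
      using regular_left_cancel[OF s, of u "c \<otimes> e"] u c sR uR by (simp add: m_assoc)
    then have "y \<otimes> u = \<zero>"
      using y c u(2) by (simp add: m_assoc[symmetric])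
    then show ?thesis
      by (rule regular_elemsD(3)[OF u(1) y(1)])
  qed
  ultimately show ?thesis
    using c unfolding regular_elems_def by blast
qed

text \<open>The definition asks for one regular common denominator; this form covers every common
  multiple, so that later computations may use whichever is at hand. The two are linked by c u = c0
  e with u regular, which is cancelled at the end.\<close>

lemma fract_rel_iff:
  assumes "a \<in> carrier R" "s \<in> regular_elems R" "b \<in> carrier R" "t \<in> regular_elems R"
  shows "((a, s), (b, t)) \<in> fract_rel R \<longleftrightarrow>
    (\<forall>c\<in>carrier R. \<forall>d\<in>carrier R. s \<otimes> c = t \<otimes> d \<longrightarrow> a \<otimes> c = b \<otimes> d)"
proof (intro iffI ballI impI)
  have sR: "s \<in> carrier R" "t \<in> carrier R"
    using assms regular_elemsD(1) by auto
  assume "((a, s), (b, t)) \<in> fract_rel R"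
  then obtain c0 d0 where 0: "c0 \<in> carrier R" "d0 \<in> carrier R" "s \<otimes> c0 = t \<otimes> d0"
      "s \<otimes> c0 \<in> regular_elems R" "a \<otimes> c0 = b \<otimes> d0"
    by (auto simp: fract_rel_def)
  fix c d assume cd: "c \<in> carrier R" "d \<in> carrier R" "s \<otimes> c = t \<otimes> d"
  obtain u e where u: "u \<in> regular_elems R" "e \<in> carrier R" "c \<otimes> u = c0 \<otimes> e"
    using ore[OF cd(1) regular_right_factor[OF assms(2) 0(1,4)]] by blast
  have uR: "u \<in> carrier R" by (rule regular_elemsD(1)[OF u(1)])
  have "t \<otimes> (d \<otimes> u) = s \<otimes> (c \<otimes> u)"
    using cd sR uR by (simp add: m_assoc[symmetric])
  also have "\<dots> = t \<otimes> (d0 \<otimes> e)"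
    unfolding u(3) using 0 sR u(2) by (simp add: m_assoc[symmetric])
  finally have "d \<otimes> u = d0 \<otimes> e"
    using regular_left_cancel[OF assms(4)] cd uR 0 u by simp
  then have "(b \<otimes> d) \<otimes> u = b \<otimes> d0 \<otimes> e"
    using assms(3) cd(2) uR 0(2) u(2) by (simp add: m_assoc)
  moreover have "(a \<otimes> c) \<otimes> u = a \<otimes> c0 \<otimes> e"
    using assms(1) cd(1) uR 0(1) u(2,3) by (simp add: m_assoc)
  ultimately show "a \<otimes> c = b \<otimes> d"
    using regular_right_cancel[OF u(1), of "a \<otimes> c" "b \<otimes> d"] assms(1,3) cd(1,2) 0(5) by simp
next
  assume *: "\<forall>c\<in>carrier R. \<forall>d\<in>carrier R. s \<otimes> c = t \<otimes> d \<longrightarrow> a \<otimes> c = b \<otimes> d"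
  have sR: "s \<in> carrier R" by (rule regular_elemsD(1)[OF assms(2)])
  obtain u c where u: "u \<in> regular_elems R" "c \<in> carrier R" "s \<otimes> u = t \<otimes> c"
    using ore[OF sR assms(4)] by blast
  moreover have "u \<in> carrier R" by (rule regular_elemsD(1)[OF u(1)])
  moreover have "s \<otimes> u \<in> regular_elems R" using assms(2) u(1) by (rule regular_mult)
  ultimately show "((a, s), (b, t)) \<in> fract_rel R"
    unfolding fract_rel_def using assms * by blast
qed

lemma equiv_fract_rel: "equiv (carrier R \<times> regular_elems R) (fract_rel R)"
proof (rule equivI)
  show "fract_rel R \<subseteq> (carrier R \<times> regular_elems R) \<times> (carrier R \<times> regular_elems R)"
    by (auto simp: fract_rel_def)
  show "refl_on (carrier R \<times> regular_elems R) (fract_rel R)"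
    by (auto simp: refl_on_def fract_rel_def regular_elemsD(1) intro!: bexI[of _ \<one>])
  show "sym (fract_rel R)"
    by (rule symI) (force simp: fract_rel_def)
  show "trans (fract_rel R)"
  proof (rule transI, clarify)
    fix a s b t e w
    assume 1: "((a, s), (b, t)) \<in> fract_rel R" and 2: "((b, t), (e, w)) \<in> fract_rel R"
    then have D: "a \<in> carrier R" "s \<in> regular_elems R" "b \<in> carrier R" "t \<in> regular_elems R"
        "e \<in> carrier R" "w \<in> regular_elems R"
      by (auto simp: fract_rel_def)
    have sR: "s \<in> carrier R" "t \<in> carrier R"
      using D regular_elemsD(1) by auto
    \<comment> \<open>The three denominators are brought to the common multiple s u v = t c v = w d,
      where the numerators are compared.\<close>
    obtain u c where u: "u \<in> regular_elems R" "c \<in> carrier R" "s \<otimes> u = t \<otimes> c"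
      using ore[OF sR(1) D(4)] by blast
    have uR: "u \<in> carrier R" by (rule regular_elemsD(1)[OF u(1)])
    obtain v d where v: "v \<in> regular_elems R" "d \<in> carrier R" "s \<otimes> u \<otimes> v = w \<otimes> d"
      using ore[of "s \<otimes> u" w] D sR uR by auto
    have vR: "v \<in> carrier R" by (rule regular_elemsD(1)[OF v(1)])
    have "a \<otimes> u = b \<otimes> c"
      using 1 u uR unfolding fract_rel_iff[OF D(1-4)] by blast
    moreover have "b \<otimes> (c \<otimes> v) = e \<otimes> d"
    proof -
      have "t \<otimes> (c \<otimes> v) = w \<otimes> d"
        using u v sR vR by (simp add: m_assoc[symmetric])
      then show ?thesis
        using 2 u v vR unfolding fract_rel_iff[OF D(3-6)] by blast
    qed
    ultimately have "a \<otimes> (u \<otimes> v) = e \<otimes> d"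
      using D u uR vR by (metis m_assoc)
    moreover have "s \<otimes> (u \<otimes> v) = w \<otimes> d"
      using v sR uR vR by (simp add: m_assoc)
    moreover have "s \<otimes> (u \<otimes> v) \<in> regular_elems R"
      using D u v by (intro regular_mult)
    ultimately show "((a, s), (e, w)) \<in> fract_rel R"
      unfolding fract_rel_def using D v(2) m_closed[OF uR vR] by blast
  qed
qed

section \<open>Products of fractions\<close>

definition frac :: "'a \<Rightarrow> 'a \<Rightarrow> ('a \<times> 'a) set" where
  "frac a s = fract_rel R `` {(a, s)}"

lemma frac_eqI:
  assumes "((a, s), (b, t)) \<in> fract_rel R"
  shows "frac a s = frac b t"
  unfolding frac_def using equiv_class_eq[OF equiv_fract_rel assms] .

lemma fract_of_eq: "fract_of R a = frac a \<one>"
  by (simp add: fract_of_def frac_def)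

lemma carrier_Fract: "carrier (Fract R) = {frac a s | a s. a \<in> carrier R \<and> s \<in> regular_elems R}"
  by (auto simp: Fract_def quotient_def frac_def)

lemma frac_closed: "\<lbrakk>a \<in> carrier R; s \<in> regular_elems R\<rbrakk> \<Longrightarrow> frac a s \<in> carrier (Fract R)"
  by (auto simp: carrier_Fract)

lemma frac_carrierE:
  assumes "p \<in> carrier (Fract R)"
  obtains a s where "a \<in> carrier R" "s \<in> regular_elems R" "p = frac a s"
  using assms by (auto simp: carrier_Fract)

lemma one_Fract: "\<one>\<^bsub>Fract R\<^esub> = frac \<one> \<one>"
  by (simp add: Fract_def fract_of_eq)

text \<open>\<open>Fract\<close> collects the results of all choices of representatives and of u and
  c. They are all equivalent by \<open>fract_rel_iff\<close>, applied to the denominators t, t' and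
  then to s, s'.\<close>

lemma frac_mult:
  assumes D: "a \<in> carrier R" "s \<in> regular_elems R" "b \<in> carrier R" "t \<in> regular_elems R"
    and c: "c \<in> carrier R" "u \<in> regular_elems R" "b \<otimes> u = s \<otimes> c"
  shows "frac a s \<otimes>\<^bsub>Fract R\<^esub> frac b t = frac (a \<otimes> c) (t \<otimes> u)"
proof -
  let ?X = "{(a' \<otimes> c', t' \<otimes> u') | a' s' b' t' c' u'.
    (a', s') \<in> frac a s \<and> (b', t') \<in> frac b t \<and> c' \<in> carrier R \<and> u' \<in> regular_elems R \<and>
    b' \<otimes> u' = s' \<otimes> c'}"
  have uR: "u \<in> carrier R" "t \<in> carrier R" "s \<in> carrier R"
    using regular_elemsD(1) c D by auto
  have "((a \<otimes> c, t \<otimes> u), x) \<in> fract_rel R" if "x \<in> ?X" for x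
  proof -
    from that obtain a' s' b' t' c' u' where x: "x = (a' \<otimes> c', t' \<otimes> u')"
      and r: "((a, s), (a', s')) \<in> fract_rel R" "((b, t), (b', t')) \<in> fract_rel R"
      and c': "c' \<in> carrier R" "u' \<in> regular_elems R" "b' \<otimes> u' = s' \<otimes> c'"
      by (auto simp: frac_def)
    then have D': "a' \<in> carrier R" "s' \<in> regular_elems R" "b' \<in> carrier R" "t' \<in> regular_elems R"
      by (auto simp: fract_rel_def)
    have u'R: "u' \<in> carrier R" "t' \<in> carrier R" "s' \<in> carrier R"
      using regular_elemsD(1) c' D' by auto
    show ?thesis
      unfolding x
    proof (subst fract_rel_iff, goal_cases)
      case 5
      show ?case
      proof (intro ballI impI)
        fix y z assume yz: "y \<in> carrier R" "z \<in> carrier R" "t \<otimes> u \<otimes> y = t' \<otimes> u' \<otimes> z"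
        then have "t \<otimes> (u \<otimes> y) = t' \<otimes> (u' \<otimes> z)"
          using uR u'R by (simp add: m_assoc)
        then have "b \<otimes> (u \<otimes> y) = b' \<otimes> (u' \<otimes> z)"
          using r(2) uR u'R yz unfolding fract_rel_iff[OF D(3,4) D'(3,4)] by simp
        then have "b \<otimes> u \<otimes> y = b' \<otimes> u' \<otimes> z"
          using D D' uR u'R yz by (simp add: m_assoc)
        then have "s \<otimes> (c \<otimes> y) = s' \<otimes> (c' \<otimes> z)"
          unfolding c(3) c'(3) using c(1) c'(1) uR u'R yz by (simp add: m_assoc)
        then have "a \<otimes> (c \<otimes> y) = a' \<otimes> (c' \<otimes> z)"
          using r(1) c(1) c'(1) yz unfolding fract_rel_iff[OF D(1,2) D'(1,2)] by simp
        then show "a \<otimes> c \<otimes> y = a' \<otimes> c' \<otimes> z"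
          using D D' c(1) c'(1) yz by (simp add: m_assoc)
      qed
    qed (use D D' c c' regular_mult in auto)
  qed
  moreover have self: "((a, s), (a, s)) \<in> fract_rel R" "((b, t), (b, t)) \<in> fract_rel R"
    using equiv_fract_rel D by (auto simp: equiv_def refl_on_def)
  then have "(a \<otimes> c, t \<otimes> u) \<in> ?X"
    using c unfolding frac_def by blast
  ultimately have "fract_rel R `` ?X = frac (a \<otimes> c) (t \<otimes> u)"
    unfolding frac_def using equiv_fract_rel[THEN equiv_def[THEN iffD1]]
    by (blast dest: transD)
  then show ?thesis
    by (simp add: Fract_def)
qed

lemma frac_mult_ex:
  assumes "a \<in> carrier R" "s \<in> regular_elems R" "b \<in> carrier R" "t \<in> regular_elems R"
  obtains c u where "c \<in> carrier R" "u \<in> regular_elems R" "b \<otimes> u = s \<otimes> c"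
    "frac a s \<otimes>\<^bsub>Fract R\<^esub> frac b t = frac (a \<otimes> c) (t \<otimes> u)"
  using ore[OF assms(3,2)] frac_mult[OF assms] by blast

lemma monoid_Fract: "monoid (Fract R)"
proof (rule monoidI)
  show "\<one>\<^bsub>Fract R\<^esub> \<in> carrier (Fract R)"
    by (simp add: one_Fract frac_closed one_regular)
  show "p \<otimes>\<^bsub>Fract R\<^esub> q \<in> carrier (Fract R)" if pq: "p \<in> carrier (Fract R)" "q \<in> carrier (Fract R)" for p q
  proof -
    obtain a s b t where D: "a \<in> carrier R" "s \<in> regular_elems R" "b \<in> carrier R" "t \<in> regular_elems R"
        "p = frac a s" "q = frac b t"
      using pq by (metis frac_carrierE)
    obtain c u where "c \<in> carrier R" "u \<in> regular_elems R"
        "frac a s \<otimes>\<^bsub>Fract R\<^esub> frac b t = frac (a \<otimes> c) (t \<otimes> u)"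
      using frac_mult_ex[OF D(1-4)] by metis
    then show ?thesis
      using D frac_closed regular_mult by simp
  qed
  show "\<one>\<^bsub>Fract R\<^esub> \<otimes>\<^bsub>Fract R\<^esub> p = p" "p \<otimes>\<^bsub>Fract R\<^esub> \<one>\<^bsub>Fract R\<^esub> = p"
    if p: "p \<in> carrier (Fract R)" for p
  proof -
    obtain a s where D: "a \<in> carrier R" "s \<in> regular_elems R" "p = frac a s"
      using p by (metis frac_carrierE)
    note sR = regular_elemsD(1)[OF D(2)]
    show "\<one>\<^bsub>Fract R\<^esub> \<otimes>\<^bsub>Fract R\<^esub> p = p"
      using frac_mult[of \<one> \<one> a s a \<one>] D sR one_regular by (simp add: one_Fract)
    show "p \<otimes>\<^bsub>Fract R\<^esub> \<one>\<^bsub>Fract R\<^esub> = p"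
      using frac_mult[of a s \<one> \<one> \<one> s] D sR one_regular by (simp add: one_Fract)
  qed
  show "p \<otimes>\<^bsub>Fract R\<^esub> q \<otimes>\<^bsub>Fract R\<^esub> r = p \<otimes>\<^bsub>Fract R\<^esub> (q \<otimes>\<^bsub>Fract R\<^esub> r)"
    if pqr: "p \<in> carrier (Fract R)" "q \<in> carrier (Fract R)" "r \<in> carrier (Fract R)" for p q r
  proof -
    obtain a s b t d w where D: "a \<in> carrier R" "s \<in> regular_elems R" "b \<in> carrier R"
        "t \<in> regular_elems R" "d \<in> carrier R" "w \<in> regular_elems R"
      and eq: "p = frac a s" "q = frac b t" "r = frac d w"
      using pqr by (metis frac_carrierE)
    obtain c u where c: "c \<in> carrier R" "u \<in> regular_elems R" "b \<otimes> u = s \<otimes> c"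
      using ore[OF D(3,2)] by blast
    \<comment> \<open>Choosing e and v for the denominator t u of the product p q makes the same
      pair serve for both bracketings.\<close>
    obtain e v where e: "e \<in> carrier R" "v \<in> regular_elems R" "d \<otimes> v = t \<otimes> u \<otimes> e"
      using ore[OF D(5) regular_mult[OF D(4) c(2)]] by blast
    have R: "s \<in> carrier R" "t \<in> carrier R" "w \<in> carrier R" "u \<in> carrier R" "v \<in> carrier R"
      using D c e regular_elemsD(1) by auto
    have "p \<otimes>\<^bsub>Fract R\<^esub> q \<otimes>\<^bsub>Fract R\<^esub> r = frac (a \<otimes> c \<otimes> e) (w \<otimes> v)"
      unfolding eq frac_mult[OF D(1-4) c] using D c e regular_mult by (intro frac_mult) auto
    moreover have "q \<otimes>\<^bsub>Fract R\<^esub> r = frac (b \<otimes> (u \<otimes> e)) (w \<otimes> v)"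
      unfolding eq using D c e R by (intro frac_mult) (auto simp: m_assoc)
    moreover have "frac a s \<otimes>\<^bsub>Fract R\<^esub> frac (b \<otimes> (u \<otimes> e)) (w \<otimes> v) = frac (a \<otimes> (c \<otimes> e)) (w \<otimes> v \<otimes> \<one>)"
    proof (rule frac_mult)
      have "b \<otimes> (u \<otimes> e) = s \<otimes> c \<otimes> e"
        unfolding c(3)[symmetric] using D(3) e(1) R by (simp add: m_assoc)
      then show "b \<otimes> (u \<otimes> e) \<otimes> \<one> = s \<otimes> (c \<otimes> e)"
        using D(3) c(1) e(1) R by (simp add: m_assoc)
    qed (use D c e R one_regular regular_mult in auto)
    ultimately show ?thesis
      using D c e R by (simp add: eq(1) m_assoc)
  qed
qed

end

text \<open>A single \<open>\<phi> i\<close> need not extend to fractions, but any finite number of fractions, and the relations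
  between them, are carried over by almost all \<open>\<phi> i\<close>.\<close>

locale fract_hom_family = A: right_ore_ring A + B: right_ore_ring B
  for A :: "('a, 'm) ring_scheme" and B :: "('b, 'n) ring_scheme" +
  fixes \<phi> :: "'i \<Rightarrow> 'a \<Rightarrow> 'b" and F :: "'i filter"
  assumes hom: "\<forall>\<^sub>F i in F. \<phi> i \<in> ring_hom A B"
    and regular: "s \<in> regular_elems A \<Longrightarrow> \<forall>\<^sub>F i in F. \<phi> i s \<in> regular_elems B"
begin

text \<open>The value depends on an arbitrary representative of p. For each fixed p this is
  harmless, as any two representatives agree for almost all i.\<close>

definition ev :: "('a \<times> 'a) set \<Rightarrow> 'i \<Rightarrow> ('b \<times> 'b) set" where
  "ev p i = (let (a, s) = (SOME x. x \<in> p) in B.frac (\<phi> i a) (\<phi> i s))"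

text \<open>The two representatives have a regular common denominator, and almost all
  \<open>\<phi> i\<close> keep it and both given denominators regular.\<close>

lemma ev_frac:
  assumes "a \<in> carrier A" "s \<in> regular_elems A"
  shows "\<forall>\<^sub>F i in F. ev (A.frac a s) i = B.frac (\<phi> i a) (\<phi> i s)"
proof -
  obtain b t where bt: "(SOME x. x \<in> A.frac a s) = (b, t)" by fastforce
  have "(a, s) \<in> A.frac a s"
    unfolding A.frac_def using A.equiv_fract_rel assms by (auto simp: equiv_def refl_on_def)
  then have "(b, t) \<in> A.frac a s"
    using bt by (metis someI)
  then obtain c d where D: "b \<in> carrier A" "t \<in> regular_elems A" "c \<in> carrier A" "d \<in> carrier A"
      "s \<otimes>\<^bsub>A\<^esub> c = t \<otimes>\<^bsub>A\<^esub> d" "s \<otimes>\<^bsub>A\<^esub> c \<in> regular_elems A" "a \<otimes>\<^bsub>A\<^esub> c = b \<otimes>\<^bsub>A\<^esub> d"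
    by (auto simp: A.frac_def fract_rel_def)
  have R: "s \<in> carrier A" "t \<in> carrier A"
    using assms D A.regular_elemsD(1) by auto
  have "\<forall>\<^sub>F i in F. B.frac (\<phi> i b) (\<phi> i t) = B.frac (\<phi> i a) (\<phi> i s)"
    using hom regular[OF assms(2)] regular[OF D(2)] regular[OF D(6)]
  proof eventually_elim
    case (elim i)
    note h = ring_hom_closed[OF elim(1)] ring_hom_mult[OF elim(1)]
    have "\<phi> i s \<otimes>\<^bsub>B\<^esub> \<phi> i c = \<phi> i t \<otimes>\<^bsub>B\<^esub> \<phi> i d" "\<phi> i a \<otimes>\<^bsub>B\<^esub> \<phi> i c = \<phi> i b \<otimes>\<^bsub>B\<^esub> \<phi> i d"
      "\<phi> i s \<otimes>\<^bsub>B\<^esub> \<phi> i c \<in> regular_elems B"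
      using D R assms elim(4) by (simp_all flip: h(2))
    then have "((\<phi> i a, \<phi> i s), (\<phi> i b, \<phi> i t)) \<in> fract_rel B"
      unfolding fract_rel_def using h(1) D assms elim by blast
    then show ?case
      using B.frac_eqI by blast
  qed
  then show ?thesis
    by (simp add: ev_def bt)
qed

lemma ev_closed:
  assumes "p \<in> carrier (Fract A)"
  shows "\<forall>\<^sub>F i in F. ev p i \<in> carrier (Fract B)"
proof -
  obtain a s where D: "a \<in> carrier A" "s \<in> regular_elems A" "p = A.frac a s"
    using assms by (metis A.frac_carrierE)
  show ?thesis
    using ev_frac[OF D(1,2)] hom regular[OF D(2)]
    by eventually_elim (auto simp: D B.frac_closed ring_hom_closed)
qed

lemma ev_one: "\<forall>\<^sub>F i in F. ev \<one>\<^bsub>Fract A\<^esub> i = \<one>\<^bsub>Fract B\<^esub>"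
  using ev_frac[OF A.one_closed A.one_regular] hom
  by eventually_elim (auto simp: A.one_Fract B.one_Fract ring_hom_one)

lemma ev_mult:
  assumes "p \<in> carrier (Fract A)" "q \<in> carrier (Fract A)"
  shows "\<forall>\<^sub>F i in F. ev (p \<otimes>\<^bsub>Fract A\<^esub> q) i = ev p i \<otimes>\<^bsub>Fract B\<^esub> ev q i"
proof -
  obtain a s b t where D: "a \<in> carrier A" "s \<in> regular_elems A" "b \<in> carrier A"
      "t \<in> regular_elems A" "p = A.frac a s" "q = A.frac b t"
    using assms by (metis A.frac_carrierE)
  obtain c u where c: "c \<in> carrier A" "u \<in> regular_elems A" "b \<otimes>\<^bsub>A\<^esub> u = s \<otimes>\<^bsub>A\<^esub> c"
      "p \<otimes>\<^bsub>Fract A\<^esub> q = A.frac (a \<otimes>\<^bsub>A\<^esub> c) (t \<otimes>\<^bsub>A\<^esub> u)"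
    using A.frac_mult_ex[OF D(1-4)] D(5,6) by metis
  have R: "s \<in> carrier A" "t \<in> carrier A" "u \<in> carrier A"
    using D c A.regular_elemsD(1) by auto
  have "a \<otimes>\<^bsub>A\<^esub> c \<in> carrier A" "t \<otimes>\<^bsub>A\<^esub> u \<in> regular_elems A"
    using D c A.regular_mult by auto
  from ev_frac[OF this] ev_frac[OF D(1,2)] ev_frac[OF D(3,4)] hom
    regular[OF D(2)] regular[OF D(4)] regular[OF c(2)]
  show ?thesis
  proof eventually_elim
    case (elim i)
    note h = ring_hom_closed[OF elim(4)] ring_hom_mult[OF elim(4)]
    have "B.frac (\<phi> i a) (\<phi> i s) \<otimes>\<^bsub>Fract B\<^esub> B.frac (\<phi> i b) (\<phi> i t) =
        B.frac (\<phi> i a \<otimes>\<^bsub>B\<^esub> \<phi> i c) (\<phi> i t \<otimes>\<^bsub>B\<^esub> \<phi> i u)"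
      using D c R elim by (intro B.frac_mult) (auto simp: h(1) simp flip: h(2))
    moreover have "ev p i = B.frac (\<phi> i a) (\<phi> i s)" "ev q i = B.frac (\<phi> i b) (\<phi> i t)"
      using elim(2,3) by (simp_all only: D(5,6))
    moreover have "ev (p \<otimes>\<^bsub>Fract A\<^esub> q) i = B.frac (\<phi> i a \<otimes>\<^bsub>B\<^esub> \<phi> i c) (\<phi> i t \<otimes>\<^bsub>B\<^esub> \<phi> i u)"
      using elim(1) D(1) c(1) R by (simp add: c(4) h(2))
    ultimately show ?case by simp
  qed
qed

lemma ev_unit:
  assumes x: "x \<in> Units (Fract A)"
  shows "\<forall>\<^sub>F i in F. ev x i \<in> Units (Fract B) \<and> inv\<^bsub>Fract B\<^esub> (ev x i) = ev (inv\<^bsub>Fract A\<^esub> x) i"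
proof -
  interpret FA: monoid "Fract A" by (rule A.monoid_Fract)
  interpret FB: monoid "Fract B" by (rule B.monoid_Fract)
  have xc: "x \<in> carrier (Fract A)" "inv\<^bsub>Fract A\<^esub> x \<in> carrier (Fract A)"
    using x by auto
  show ?thesis
    using ev_closed[OF xc(1)] ev_closed[OF xc(2)] ev_one ev_mult[OF xc] ev_mult[OF xc(2,1)]
  proof eventually_elim
    case (elim i)
    have "ev x i \<otimes>\<^bsub>Fract B\<^esub> ev (inv\<^bsub>Fract A\<^esub> x) i = \<one>\<^bsub>Fract B\<^esub>"
      "ev (inv\<^bsub>Fract A\<^esub> x) i \<otimes>\<^bsub>Fract B\<^esub> ev x i = \<one>\<^bsub>Fract B\<^esub>"
      using elim x by (simp_all add: FA.Units_l_inv FA.Units_r_inv)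
    then show ?case
      using elim(1,2) FB.inv_char by (auto simp: Units_def)
  qed
qed

text \<open>An element of the derived subgroup is a finite word in commutators. Each step of
  building the word is respected for almost all i, and finitely many such conditions hold jointly
  for almost all i.\<close>

lemma derived_units_mono:
  assumes a: "a \<in> carrier A"
    and der: "fract_of A a \<in> derived (units_of (Fract A)) (Units (Fract A))"
  shows "\<forall>\<^sub>F i in F. fract_of B (\<phi> i a) \<in> derived (units_of (Fract B)) (Units (Fract B))"
proof -
  interpret FA: monoid "Fract A" by (rule A.monoid_Fract)
  interpret FB: monoid "Fract B" by (rule B.monoid_Fract)
  interpret UA: group "units_of (Fract A)" by (rule FA.units_group)
  interpret UB: group "units_of (Fract B)" by (rule FB.units_group)
  define G where "G = derived (units_of (Fract B)) (Units (Fract B))"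
  have G: "subgroup G (units_of (Fract B))"
    unfolding G_def by (rule UB.derived_is_subgroup) (simp add: units_of_carrier)

  have comm: "x \<in> Units (Fract A) \<and> (\<forall>\<^sub>F i in F. ev x i \<in> G)"
    if x_comm: "x \<in> derived_set (units_of (Fract A)) (Units (Fract A))" for x
  proof -
    obtain g h where U: "g \<in> Units (Fract A)" "h \<in> Units (Fract A)"
      and x: "x = g \<otimes>\<^bsub>units_of (Fract A)\<^esub> h \<otimes>\<^bsub>units_of (Fract A)\<^esub> inv\<^bsub>units_of (Fract A)\<^esub> g
        \<otimes>\<^bsub>units_of (Fract A)\<^esub> inv\<^bsub>units_of (Fract A)\<^esub> h"
      using x_comm by blast
    then have "x = g \<otimes>\<^bsub>Fract A\<^esub> h \<otimes>\<^bsub>Fract A\<^esub> inv\<^bsub>Fract A\<^esub> g \<otimes>\<^bsub>Fract A\<^esub> inv\<^bsub>Fract A\<^esub> h"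
      by (simp add: units_of_mult FA.units_of_inv)
    note gh = U this
    have c: "g \<in> carrier (Fract A)" "h \<in> carrier (Fract A)" "inv\<^bsub>Fract A\<^esub> g \<in> carrier (Fract A)"
        "inv\<^bsub>Fract A\<^esub> h \<in> carrier (Fract A)"
      using gh by auto
    have c2: "g \<otimes>\<^bsub>Fract A\<^esub> h \<in> carrier (Fract A)"
        "g \<otimes>\<^bsub>Fract A\<^esub> h \<otimes>\<^bsub>Fract A\<^esub> inv\<^bsub>Fract A\<^esub> g \<in> carrier (Fract A)"
      using c by auto
    have "\<forall>\<^sub>F i in F. ev x i \<in> G"
      using ev_mult[OF c(1,2)] ev_mult[OF c2(1) c(3)] ev_mult[OF c2(2) c(4)]
        ev_unit[OF gh(1)] ev_unit[OF gh(2)]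
    proof eventually_elim
      case (elim i)
      have "ev x i = ev g i \<otimes>\<^bsub>Fract B\<^esub> ev h i \<otimes>\<^bsub>Fract B\<^esub> inv\<^bsub>Fract B\<^esub> (ev g i) \<otimes>\<^bsub>Fract B\<^esub> inv\<^bsub>Fract B\<^esub> (ev h i)"
        unfolding gh(3) using elim by simp
      then have "ev x i = ev g i \<otimes>\<^bsub>units_of (Fract B)\<^esub> ev h i \<otimes>\<^bsub>units_of (Fract B)\<^esub>
          inv\<^bsub>units_of (Fract B)\<^esub> (ev g i) \<otimes>\<^bsub>units_of (Fract B)\<^esub> inv\<^bsub>units_of (Fract B)\<^esub> (ev h i)"
        using elim(4,5) by (simp add: units_of_mult FB.units_of_inv)
      then have "ev x i \<in> derived_set (units_of (Fract B)) (Units (Fract B))"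
        using elim(4,5) by blast
      then show ?case
        unfolding G_def derived_def by (rule generate.incl)
    qed
    then show ?thesis
      using gh by (auto intro!: FA.Units_m_closed)
  qed
  \<comment> \<open>Being a unit is carried along because \<open>ev_mult\<close> is available only
    for elements of \<open>Fract A\<close>.\<close>
  have "x \<in> Units (Fract A) \<and> (\<forall>\<^sub>F i in F. ev x i \<in> G)"
    if "x \<in> derived (units_of (Fract A)) (Units (Fract A))" for x
    using that unfolding derived_def
  proof induction
    case one
    show ?case
      using ev_one subgroup.one_closed[OF G]
      by (auto simp: units_of_one elim: eventually_mono)
  next
    case (incl h)
    then show ?case by (rule comm)
  next
    case (inv h)
    have h: "h \<in> Units (Fract A)" and "\<forall>\<^sub>F i in F. ev h i \<in> G"
      using comm[OF inv] by blast+
    from ev_unit[OF h] this(2) have "\<forall>\<^sub>F i in F. ev (inv\<^bsub>Fract A\<^esub> h) i \<in> G"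
    proof eventually_elim
      case (elim i)
      then show ?case
        using subgroup.m_inv_closed[OF G, of "ev h i"] FB.units_of_inv by simp
    qed
    then show ?case
      using h FA.units_of_inv FA.Units_inv_Units by simp
  next
    case (eng x y)
    then have "\<forall>\<^sub>F i in F. ev x i \<in> G" "\<forall>\<^sub>F i in F. ev y i \<in> G"
      "\<forall>\<^sub>F i in F. ev (x \<otimes>\<^bsub>Fract A\<^esub> y) i = ev x i \<otimes>\<^bsub>Fract B\<^esub> ev y i"
      using ev_mult[of x y] by auto
    then have "\<forall>\<^sub>F i in F. ev (x \<otimes>\<^bsub>Fract A\<^esub> y) i \<in> G"
    proof eventually_elim
      case (elim i)
      then show ?case
        using subgroup.m_closed[OF G, of "ev x i" "ev y i"] by (simp add: units_of_mult)
    qed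
    then show ?case
      using eng FA.Units_m_closed by (simp add: units_of_mult)
  qed
  from conjunct2[OF this[OF der]] hom ev_frac[OF a A.one_regular] show ?thesis
    by eventually_elim (auto simp: G_def A.fract_of_eq B.fract_of_eq ring_hom_one)
qed

end

section \<open>Comparison of the invariants\<close>

sublocale semiprime_right_goldie_ring \<subseteq> right_ore_ring ..

text \<open>\<open>UP A\<close> and \<open>poly_algebra A\<close> differ only in their scalars. The
  ring theory takes place in \<open>UP A\<close>, and its results are moved across here.\<close>

locale same_ring_operations = R: ring R + S: ring S
  for R :: "('a, 'm) ring_scheme" and S :: "('a, 'n) ring_scheme" +
  assumes same: "carrier S = carrier R" "mult S = mult R" "one S = one R" "zero S = zero R"
    "add S = add R"
begin

lemma right_ideal_same: "right_ideal I S \<longleftrightarrow> right_ideal I R"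
proof
  assume "right_ideal I S"
  then show "right_ideal I R"
    using S.right_idealD[of I] by (intro R.right_idealI) (simp_all add: same)
next
  assume "right_ideal I R"
  then show "right_ideal I S"
    using R.right_idealD[of I] by (intro S.right_idealI) (simp_all add: same)
qed

lemma finsum_same: "finsum S x F = finsum R x F"
  by (simp add: finsum_def finprod_def same)

lemma right_goldie_same:
  assumes "right_goldie_ring R"
  shows "right_goldie_ring S"
proof
  interpret R: right_goldie_ring R by fact
  have ann: "right_annihilator S X = right_annihilator R X" for X
    by (simp add: right_annihilator_def same)
  show "\<exists>N. \<forall>n\<ge>N. right_annihilator S (X n) = right_annihilator S (X N)"
    if "\<And>n. X n \<subseteq> carrier S" "\<And>n. right_annihilator S (X n) \<subseteq> right_annihilator S (X (Suc n))"
    for X :: "nat \<Rightarrow> 'a set"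
    using R.acc_right_annihilators[of X] that by (simp add: ann same)
  show "\<not> independent_family S I"
    if "\<And>n. right_ideal (I n) S" "\<And>n. I n \<noteq> {\<zero>\<^bsub>S\<^esub>}" for I
    using R.no_infinite_direct_sum[of I] that
    by (simp add: independent_family_def finsum_same right_ideal_same same)
qed

lemma semiprime_same:
  assumes "semiprime_ring R"
  shows "semiprime_ring S"
proof
  interpret R: semiprime_ring R by fact
  fix I assume I: "ideal I S" and I2: "I \<cdot>\<^bsub>S\<^esub> I \<subseteq> {\<zero>\<^bsub>S\<^esub>}"
  interpret I: ideal I S by fact
  have "right_ideal I S"
    using I.additive_subgroup_axioms I.I_r_closed by (simp add: right_ideal_def)
  then have "additive_subgroup I R"
    using right_ideal_same by (simp add: right_ideal_def)
  then have "ideal I R"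
    using I.I_l_closed I.I_r_closed
    by (intro ideal.intro R.ring_axioms ideal_axioms.intro) (simp_all add: same)
  moreover have "x \<in> I \<cdot>\<^bsub>S\<^esub> I" if "x \<in> I \<cdot>\<^bsub>R\<^esub> I" for x
    using that
  proof induction
    case (prod i j)
    then show ?case using ideal_prod.prod[of i I j I S] by (simp add: same)
  next
    case (sum a b)
    then show ?case using ideal_prod.sum[of a S I I b] by (simp add: same)
  qed
  ultimately have "I = {\<zero>\<^bsub>R\<^esub>}"
    using R.semiprime[of I] I2 by (auto simp: same)
  then show "I = {\<zero>\<^bsub>S\<^esub>}" by (simp add: same)
qed

lemma Fract_same: "Fract S = Fract R"
  by (simp add: Fract_def fract_of_def fract_rel_def regular_elems_def same)

lemma fract_of_same: "fract_of S = fract_of R"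
  by (simp add: fun_eq_iff fract_of_def fract_rel_def regular_elems_def same)

end

lemma same_ring_operations_poly_algebra:
  assumes "assoc_algebra K A"
  shows "same_ring_operations (UP A) (poly_algebra A)"
proof -
  interpret assoc_algebra K A by fact
  interpret U: UP_ring A "UP A" by unfold_locales
  interpret B: assoc_algebra K "poly_algebra A"
    by (rule poly_algebra_assoc_algebra) fact
  show ?thesis
    by unfold_locales (simp_all add: poly_algebra_def)
qed

lemma poly_algebra_scalar:
  assumes "assoc_algebra K A" "k \<in> carrier K"
  shows "k \<odot>\<^bsub>poly_algebra A\<^esub> \<one>\<^bsub>poly_algebra A\<^esub> = monom (UP A) (k \<odot>\<^bsub>A\<^esub> \<one>\<^bsub>A\<^esub>) 0"
proof -
  interpret assoc_algebra K A by fact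
  show ?thesis
    using assms(2) by (auto simp: poly_algebra_def UP_def fun_eq_iff smult_r_null)
qed

theorem proposition7p1:
  fixes K :: "('k, 'n) ring_scheme" and A :: "('k, 'a, 'm) module_scheme"
  assumes "assoc_algebra K A"
    and "infinite (carrier K)"
    and "semiprime_ring A"
    and "right_goldie_ring A"
  shows "semiprime_ring (poly_algebra A) \<and> right_goldie_ring (poly_algebra A) \<and>
    AD K (poly_algebra A) = AD K A"
proof -
  interpret K: field K using assms(1) by (rule assoc_algebra.axioms)
  interpret KA: assoc_algebra K A by fact
  interpret semiprime_ring A by fact
  interpret right_goldie_ring A by fact
  interpret poly_semiprime_right_goldie A "UP A" by unfold_locales
  interpret same: same_ring_operations "UP A" "poly_algebra A"
    by (rule same_ring_operations_poly_algebra) fact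
  define e where "e k = k \<odot>\<^bsub>A\<^esub> \<one>\<^bsub>A\<^esub>" for k
  have e: "central (e k)" if "k \<in> carrier K" for k
    using that by (auto simp: central_def e_def KA.smult_mult_left KA.smult_mult_right)
  note eR = centralD(1)[OF e]
  have e_unit: "e k \<ominus>\<^bsub>A\<^esub> e l \<in> Units A" if kl: "k \<in> carrier K" "l \<in> carrier K" "k \<noteq> l" for k l
  proof -
    define w where "w = k \<ominus>\<^bsub>K\<^esub> l"
    have w: "w \<in> carrier K" "w \<noteq> \<zero>\<^bsub>K\<^esub>"
      using kl by (simp_all add: w_def K.minus_eq_zero_iff)
    then have wU: "w \<in> Units K"
      by (simp add: K.field_Units)
    have ew: "e k \<ominus>\<^bsub>A\<^esub> e l = e w"
      using kl by (simp add: e_def w_def KA.minus_eq KA.smult_l_distr KA.smult_l_minus a_minus_def)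
    have "e u \<otimes>\<^bsub>A\<^esub> e v = e (u \<otimes>\<^bsub>K\<^esub> v)" if "u \<in> carrier K" "v \<in> carrier K" for u v
      using that by (simp add: e_def KA.smult_mult_left KA.smult_assoc1)
    moreover have "e \<one>\<^bsub>K\<^esub> = \<one>\<^bsub>A\<^esub>"
      by (simp add: e_def)
    ultimately have "e w \<otimes>\<^bsub>A\<^esub> e (inv\<^bsub>K\<^esub> w) = \<one>\<^bsub>A\<^esub>" "e (inv\<^bsub>K\<^esub> w) \<otimes>\<^bsub>A\<^esub> e w = \<one>\<^bsub>A\<^esub>"
      using wU w(1) by (simp_all add: K.Units_r_inv K.Units_l_inv)
    then show ?thesis
      unfolding ew Units_def using eR[OF w(1)] eR[OF K.Units_inv_closed[OF wU]] by blast
  qed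
  \<comment> \<open>Almost all elements of \<open>carrier K\<close>: the type of scalars may have
    further elements, at which nothing is known about evaluation.\<close>
  define F where "F = inf cofinite (principal (carrier K))"
  have evF: "eventually Q F \<longleftrightarrow> finite {k \<in> carrier K. \<not> Q k}" for Q
    by (simp add: F_def eventually_inf_principal eventually_cofinite)
  have evI: "eventually Q F" if "\<And>k. k \<in> carrier K \<Longrightarrow> Q k" for Q
    using that by (simp add: F_def eventually_inf_principal)
  \<comment> \<open>Infinitude of the field enters here: it makes the filter proper, so that a
    statement independent of k which holds for almost all k is true.\<close>
  have F_const: "Q" if "\<forall>\<^sub>F k in F. Q" for Q
    using that assms(2) by (cases Q) (auto simp: evF)
  \<comment> \<open>The embedding by constants does not depend on k. As a constant family it obtains
    its half of the equality from the same lemma as evaluation does.\<close>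
  interpret const: fract_hom_family A "UP A" "\<lambda>k a. monom (UP A) a 0" F
  proof unfold_locales
    show "\<forall>\<^sub>F k in F. (\<lambda>a. monom (UP A) a 0) \<in> ring_hom A (UP A)"
      by (intro always_eventually allI ring_hom_memI) (auto simp: monom_0_mult simp del: monom_mult)
    show "\<forall>\<^sub>F k in F. monom (UP A) s 0 \<in> regular_elems (UP A)" if "s \<in> regular_elems A" for s
      using const_regular that by auto
  qed
  interpret eval: fract_hom_family "UP A" A "\<lambda>k. evalp (e k)" F
  proof unfold_locales
    show "\<forall>\<^sub>F k in F. evalp (e k) \<in> ring_hom (UP A) A"
      by (intro evI evalp_hom e)
    fix s assume s: "s \<in> regular_elems (UP A)"
    show "\<forall>\<^sub>F k in F. evalp (e k) s \<in> regular_elems A"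
      unfolding evF
    proof (rule ccontr)
      \<comment> \<open>An infinite exceptional set would contain a sequence of distinct scalars,
        which \<open>eval_eventually_regular\<close> excludes.\<close>
      assume "infinite {k \<in> carrier K. evalp (e k) s \<notin> regular_elems A}"
      then obtain z :: "nat \<Rightarrow> 'k" where z: "inj z" "range z \<subseteq> {k \<in> carrier K. evalp (e k) s \<notin> regular_elems A}"
        using infinite_countable_subset by blast
      have "\<exists>n. evalp (e (z n)) s \<in> regular_elems A"
        using z e by (intro eval_eventually_regular[OF s] e_unit) (auto dest: injD)
      then show False using z(2) by blast
    qed
  qed
  have "fract_of (UP A) (monom (UP A) (e k) 0) \<in> derived (units_of (Fract (UP A))) (Units (Fract (UP A)))
      \<longleftrightarrow> fract_of A (e k) \<in> derived (units_of (Fract A)) (Units (Fract A))"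
    if k: "k \<in> carrier K" for k
  proof
    assume "fract_of A (e k) \<in> derived (units_of (Fract A)) (Units (Fract A))"
    from F_const[OF const.derived_units_mono[OF eR[OF k] this]]
    show "fract_of (UP A) (monom (UP A) (e k) 0) \<in> derived (units_of (Fract (UP A))) (Units (Fract (UP A)))" .
  next
    assume "fract_of (UP A) (monom (UP A) (e k) 0) \<in> derived (units_of (Fract (UP A))) (Units (Fract (UP A)))"
    from eval.derived_units_mono[OF monom_closed[OF eR[OF k]] this]
    have "\<forall>\<^sub>F l in F. fract_of A (evalp (e l) (monom (UP A) (e k) 0)) \<in> derived (units_of (Fract A)) (Units (Fract A))" .
    moreover have "\<forall>\<^sub>F l in F. evalp (e l) (monom (UP A) (e k) 0) = e k"
      by (intro evI evalp_const eR k)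
    ultimately have "\<forall>\<^sub>F l in F. fract_of A (e k) \<in> derived (units_of (Fract A)) (Units (Fract A))"
      by eventually_elim simp
    then show "fract_of A (e k) \<in> derived (units_of (Fract A)) (Units (Fract A))"
      by (rule F_const)
  qed
  then have "AD K (poly_algebra A) = AD K A"
    by (auto simp: AD_def poly_algebra_scalar[OF assms(1)] same.Fract_same same.fract_of_same e_def)
  moreover have "semiprime_ring (poly_algebra A)"
    by (rule same.semiprime_same) (rule PG.semiprime_ring_axioms)
  moreover have "right_goldie_ring (poly_algebra A)"
    by (rule same.right_goldie_same) (rule PG.right_goldie_ring_axioms)
  ultimately show ?thesis by blast
qed

end
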